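(* Let $(M,g)$ be a compact $n$-dimensional Riemannian manifold and $k\ge0$ an integer with $2k<n$. If the Einstein-Lovelock tensor $T_{2k}$ of $(M,g)$ is positive definite (or negative definite), then every smooth $\ell_{2k}$-harmonic function on $M$ is constant.
   Context: Double forms. On an $n$-dimensional Euclidean vector space $(V,g)$, a $(p,q)$-double form is an element of $\Lambda^pV^*\otimes\Lambda^qV^*$, viewed as a bilinear form $\Lambda^pV\times\Lambda^qV\to\mathbb R$. The exterior product is $(\theta_1\otimes\theta_2)(\theta_3\otimes\theta_4)=(\theta_1\wedge\theta_3)\otimes(\theta_2\wedge\theta_4)$, so that $B^k(x_1\wedge\dots\wedge x_k,y_1\wedge\dots\wedge y_k)=k!\det[B(x_i,y_j)]$ for a symmetric bilinear form $B$. The generalized Hodge star on $(p,q)$-double forms is $*\omega(\cdot,\cdot)=(-1)^{(p+q)(n-p-q)}\omega( *\cdot,*\cdot)$, with the usual Hodge star on the right. For $(1,1)$-double forms, $\langle S,T\rangle=\sum_{i,j}S(e_i,e_j)T(e_i,e_j)$ with $(e_i)$ orthonormal. These operations are applied pointwise on tangent spaces. The Riemann tensor $R$ of $(M,g)$ is viewed as a symmetric $(2,2)$-double form, with sign such that $R(x\wedge y,x\wedge y)$ is the sectional curvature for orthonormal $x,y$. The $(2k)$-th Einstein-Lovelock tensor is the symmetric bilinear form $T_{2k}=*\frac{1}{(n-2k-1)!}g^{n-2k-1}R^k$ for $2k<n$ (so $T_0=g$). For a smooth function $f$ with Hessian $\mathrm{Hess}(f)$, $\ell_{2k}(f)=-\langle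 T_{2k},\mathrm{Hess}(f)\rangle$; $f$ is $\ell_{2k}$-harmonic if $\ell_{2k}(f)=0$.
   Formalization: The manifold M is additionally assumed connected; on a disconnected compact manifold, locally constant functions are ℓ_{2k}-harmonic without being constant, so the claim fails there. *)

theory Defs
  imports "HOL-Analysis.Analysis"
begin

section \<open>The exterior algebra of \<open>\<real>\<^sup>n\<close>\<close>

text \<open>
  The index type \<open>'n\<close> is linearly ordered and \<open>n = CARD('n)\<close>. An element of the full exterior
  algebra of \<open>V = \<real>\<^sup>n\<close> is given by its coefficients in the basis
  \<open>e\<^sub>I = e\<^sub>i\<^sub>1 \<and> \<dots> \<and> e\<^sub>i\<^sub>p\<close>, where \<open>I = {i\<^sub>1 < \<dots> < i\<^sub>p}\<close>; the degree \<open>p\<close> part consists of the elements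
  supported on sets of cardinality \<open>p\<close>. The same type with the dual basis \<open>\<theta>\<^sup>I\<close> represents the
  exterior algebra of \<open>V\<^sup>*\<close>, where \<open>\<theta>\<^sup>I\<close> takes the value \<open>1\<close> on \<open>e\<^sub>I\<close>.
\<close>

type_synonym 'n rvec = "(real, 'n) vec"
type_synonym 'n rmat = "((real, 'n) vec, 'n) vec"
type_synonym 'n ext = "real ^ 'n set"

text \<open>\<open>e\<^sub>I \<and> e\<^sub>J = shuffle_sign I J \<cdot> e\<^sub>I\<^sub>\<union>\<^sub>J\<close> for disjoint \<open>I\<close> and \<open>J\<close>.\<close>

definition shuffle_sign :: "'n::{finite,linorder} set \<Rightarrow> 'n set \<Rightarrow> real" where
  "shuffle_sign I J = (-1) ^ card {(i, j). i \<in> I \<and> j \<in> J \<and> j < i}"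

definition wedge :: "'n::{finite,linorder} ext \<Rightarrow> 'n ext \<Rightarrow> 'n ext" where
  "wedge \<alpha> \<beta> = (\<chi> A. \<Sum>I\<in>Pow A. shuffle_sign I (A - I) * \<alpha> $ I * \<beta> $ (A - I))"

definition ext_of_vec :: "'n::{finite,linorder} rvec \<Rightarrow> 'n ext" where
  "ext_of_vec v = (\<chi> I. if card I = 1 then v $ the_elem I else 0)"

text \<open>A scalar product on \<open>V\<close> is given by its matrix \<open>G\<close> in the basis \<open>e\<close>.\<close>

definition vec_inner :: "'n::finite rmat \<Rightarrow> 'n rvec \<Rightarrow> 'n rvec \<Rightarrow> real" where
  "vec_inner G u v = u \<bullet> (G *v v)"

text \<open>
  The induced scalar product of \<open>e\<^sub>I\<close> and \<open>e\<^sub>J\<close> is the Gram determinant of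
  \<open>(G\<^sub>i\<^sub>j)\<close> with \<open>i \<in> I\<close>, \<open>j \<in> J\<close>, written with the Leibniz formula; different degrees are orthogonal.
\<close>

definition gram :: "'n::{finite,linorder} rmat \<Rightarrow> 'n set \<Rightarrow> 'n set \<Rightarrow> real" where
  "gram G I J =
    (if card I = card J then
       (\<Sum>\<sigma> | \<sigma> permutes {..<card I}. of_int (sign \<sigma>) *
          (\<Prod>a<card I. G $ (sorted_list_of_set I ! a) $ (sorted_list_of_set J ! \<sigma> a)))
     else 0)"

definition ext_inner :: "'n::{finite,linorder} rmat \<Rightarrow> 'n ext \<Rightarrow> 'n ext \<Rightarrow> real" where
  "ext_inner G \<alpha> \<beta> = (\<Sum>I\<in>UNIV. \<Sum>J\<in>UNIV. gram G I J * \<alpha> $ I * \<beta> $ J)"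

text \<open>
  The unit \<open>n\<close>-vector in the orientation of \<open>e\<close>. The generalized Hodge star below
  does not depend on this choice of orientation, since it uses the usual star in both arguments.
\<close>

definition vol :: "'n::{finite,linorder} rmat \<Rightarrow> 'n ext" where
  "vol G = (\<chi> I. if I = UNIV then 1 / sqrt (det G) else 0)"

text \<open>
  The usual Hodge star, \<open>\<alpha> \<and> *\<beta> = \<langle>\<alpha>, \<beta>\<rangle> vol\<close> for \<open>\<alpha>\<close> of the same degree as \<open>\<beta>\<close>. Comparing only
  coefficients of the top degree states this for all degrees at once.
\<close>

definition hodge :: "'n::{finite,linorder} rmat \<Rightarrow> 'n ext \<Rightarrow> 'n ext" where
  "hodge G \<beta> =
    (THE \<eta>. \<forall>\<alpha>. wedge \<alpha> \<eta> $ UNIV = ext_inner G \<alpha> \<beta> * vol G $ UNIV)"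

lemma wedge_UNIV:
  "wedge \<alpha> \<eta> $ UNIV = (\<Sum>I\<in>UNIV. shuffle_sign I (- I) * \<alpha> $ I * \<eta> $ (- I))"
  by (simp add: wedge_def Compl_eq_Diff_UNIV)

lemma hodge_unique_existence:
  fixes G :: "'n::{finite,linorder} rmat"
  shows "\<exists>!\<eta>. \<forall>\<alpha>. wedge \<alpha> \<eta> $ UNIV = ext_inner G \<alpha> \<beta> * vol G $ UNIV"
proof -
  have sq: "shuffle_sign I J * shuffle_sign I J = 1" for I J :: "'n set"
    by (simp add: shuffle_sign_def flip: power_add mult_2)
  let ?c = "\<lambda>I. (\<Sum>J\<in>UNIV. gram G I J * \<beta> $ J) * vol G $ UNIV"
  have inner: "ext_inner G \<alpha> \<beta> * vol G $ UNIV = (\<Sum>I\<in>UNIV. \<alpha> $ I * ?c I)" for \<alpha>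
    unfolding ext_inner_def sum_distrib_right sum_distrib_left
    by (intro sum.cong refl) (simp add: mult_ac)
  show ?thesis
  proof (rule ex1I)
    show "\<forall>\<alpha>. wedge \<alpha> (\<chi> K. shuffle_sign (- K) K * ?c (- K)) $ UNIV =
        ext_inner G \<alpha> \<beta> * vol G $ UNIV"
    proof
      fix \<alpha> :: "'n ext"
      have *: "shuffle_sign I J * \<alpha> $ I * (shuffle_sign I J * x) = \<alpha> $ I * x" for I J :: "'n set" and x
        using sq[of I J] by algebra
      show "wedge \<alpha> (\<chi> K. shuffle_sign (- K) K * ?c (- K)) $ UNIV =
        ext_inner G \<alpha> \<beta> * vol G $ UNIV"
        unfolding inner wedge_UNIV by (simp only: vec_lambda_beta double_complement *)
    qed
  next
    fix \<eta> :: "'n ext"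
    assume \<eta>: "\<forall>\<alpha>. wedge \<alpha> \<eta> $ UNIV = ext_inner G \<alpha> \<beta> * vol G $ UNIV"
    show "\<eta> = (\<chi> K. shuffle_sign (- K) K * ?c (- K))"
    proof (rule vec_eq_iff[THEN iffD2], rule allI)
      fix K :: "'n set"
      have sel: "(\<Sum>I\<in>UNIV. a I * axis (- K) 1 $ I * b I) = a (- K) * (b (- K) :: real)" for a b
        by (subst sum.mono_neutral_right[of _ "{- K}"]) (auto simp: axis_def)
      have sel': "(\<Sum>I\<in>UNIV. axis (- K) 1 $ I * b I) = (b (- K) :: real)" for b
        by (subst sum.mono_neutral_right[of _ "{- K}"]) (auto simp: axis_def)
      have "shuffle_sign (- K) K * \<eta> $ K = ?c (- K)"
        using \<eta>[rule_format, of "axis (- K) 1"] unfolding inner wedge_UNIV sel sel' by simp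
      then have "shuffle_sign (- K) K * (shuffle_sign (- K) K * \<eta> $ K) =
          shuffle_sign (- K) K * ?c (- K)"
        by simp
      then show "\<eta> $ K = (\<chi> K. shuffle_sign (- K) K * ?c (- K)) $ K"
        by (simp add: sq flip: mult.assoc)
    qed
  qed
qed


section \<open>Double forms\<close>

text \<open>
  \<open>\<omega> $ I $ J\<close> is the coefficient of \<open>\<theta>\<^sup>I \<otimes> \<theta>\<^sup>J\<close>. A \<open>(p,q)\<close>-double form is supported on the
  pairs with \<open>card I = p\<close> and \<open>card J = q\<close>.
\<close>

type_synonym 'n dform = "real ^ 'n set ^ 'n set"

definition dform_eval :: "'n::{finite,linorder} dform \<Rightarrow> 'n ext \<Rightarrow> 'n ext \<Rightarrow> real" where
  "dform_eval \<omega> x y = (\<Sum>I\<in>UNIV. \<Sum>J\<in>UNIV. \<omega> $ I $ J * x $ I * y $ J)"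

text \<open>The bilinear extension of
  \<open>(\<theta>\<^sub>1 \<otimes> \<theta>\<^sub>2)(\<theta>\<^sub>3 \<otimes> \<theta>\<^sub>4) = (\<theta>\<^sub>1 \<and> \<theta>\<^sub>3) \<otimes> (\<theta>\<^sub>2 \<and> \<theta>\<^sub>4)\<close>.\<close>

definition dform_mult :: "'n::{finite,linorder} dform \<Rightarrow> 'n dform \<Rightarrow> 'n dform" where
  "dform_mult \<omega> \<eta> = (\<chi> A B. \<Sum>I\<in>Pow A. \<Sum>J\<in>Pow B.
      shuffle_sign I (A - I) * shuffle_sign J (B - J) * \<omega> $ I $ J * \<eta> $ (A - I) $ (B - J))"

definition dform_one :: "'n::{finite,linorder} dform" where
  "dform_one = (\<chi> I J. if I = {} \<and> J = {} then 1 else 0)"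

definition dform_power :: "'n::{finite,linorder} dform \<Rightarrow> nat \<Rightarrow> 'n dform" where
  "dform_power \<omega> m = (dform_mult \<omega> ^^ m) dform_one"

text \<open>The generalized Hodge star on \<open>(p,q)\<close>-double forms.\<close>

definition dform_hodge ::
    "'n::{finite,linorder} rmat \<Rightarrow> nat \<Rightarrow> nat \<Rightarrow> 'n dform \<Rightarrow> 'n dform" where
  "dform_hodge G p q \<omega> = (\<chi> I J.
      (-1) powi (int (p + q) * (int CARD('n) - int p - int q)) *
      dform_eval \<omega> (hodge G (axis I 1)) (hodge G (axis J 1)))"

text \<open>The \<open>(1,1)\<close>-double form of the bilinear form with matrix \<open>B\<close>.\<close>

definition dform_of_matrix :: "'n::{finite,linorder} rmat \<Rightarrow> 'n dform" where
  "dform_of_matrix B =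
    (\<chi> I J. if card I = 1 \<and> card J = 1 then B $ the_elem I $ the_elem J else 0)"

definition orthonormal_frame :: "'n::finite rmat \<Rightarrow> ('n \<Rightarrow> 'n rvec) \<Rightarrow> bool" where
  "orthonormal_frame G e \<longleftrightarrow> (\<forall>i j. vec_inner G (e i) (e j) = (if i = j then 1 else 0))"

text \<open>The scalar product of \<open>(1,1)\<close>-double forms; it is independent of the orthonormal frame.\<close>

definition dform_inner11 ::
    "'n::{finite,linorder} rmat \<Rightarrow> 'n dform \<Rightarrow> 'n dform \<Rightarrow> real" where
  "dform_inner11 G S T =
    (let e = (SOME e. orthonormal_frame G e) in
      \<Sum>i\<in>UNIV. \<Sum>j\<in>UNIV.
        dform_eval S (ext_of_vec (e i)) (ext_of_vec (e j)) *
        dform_eval T (ext_of_vec (e i)) (ext_of_vec (e j)))"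

definition pos_def11 :: "'n::{finite,linorder} dform \<Rightarrow> bool" where
  "pos_def11 S \<longleftrightarrow> (\<forall>v. v \<noteq> 0 \<longrightarrow> dform_eval S (ext_of_vec v) (ext_of_vec v) > 0)"

definition neg_def11 :: "'n::{finite,linorder} dform \<Rightarrow> bool" where
  "neg_def11 S \<longleftrightarrow> (\<forall>v. v \<noteq> 0 \<longrightarrow> dform_eval S (ext_of_vec v) (ext_of_vec v) < 0)"


section \<open>Riemannian geometry in local coordinates\<close>

text \<open>Derivatives of all orders; meaningful on open sets only.\<close>

fun Ck_on :: "nat \<Rightarrow> 'a::real_normed_vector set \<Rightarrow> ('a \<Rightarrow> 'b::real_normed_vector) \<Rightarrow> bool" where
  "Ck_on 0 S f \<longleftrightarrow> continuous_on S f"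
| "Ck_on (Suc k) S f \<longleftrightarrow>
     (\<forall>x\<in>S. f differentiable (at x)) \<and> (\<forall>v. Ck_on k S (\<lambda>x. frechet_derivative f (at x) v))"

definition smooth_on :: "'a::real_normed_vector set \<Rightarrow> ('a \<Rightarrow> 'b::real_normed_vector) \<Rightarrow> bool" where
  "smooth_on S f \<longleftrightarrow> (\<forall>k. Ck_on k S f)"

definition partial :: "'n::finite \<Rightarrow> ('n rvec \<Rightarrow> real) \<Rightarrow> 'n rvec \<Rightarrow> real" where
  "partial i F x = frechet_derivative F (at x) (axis i 1)"

text \<open>Below, \<open>G\<close> is the coordinate matrix of the metric as a function of the coordinates \<open>x\<close>.
  \<open>christoffel G l i j x\<close> is \<open>\<Gamma>\<^sup>l\<^sub>i\<^sub>j\<close>.\<close>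

definition christoffel ::
    "('n::finite rvec \<Rightarrow> 'n rmat) \<Rightarrow> 'n \<Rightarrow> 'n \<Rightarrow> 'n \<Rightarrow> 'n rvec \<Rightarrow> real" where
  "christoffel G l i j x = 1 / 2 * (\<Sum>m\<in>UNIV. matrix_inv (G x) $ l $ m *
      (partial i (\<lambda>y. G y $ j $ m) x + partial j (\<lambda>y. G y $ i $ m) x
        - partial m (\<lambda>y. G y $ i $ j) x))"

text \<open>\<open>R(\<partial>\<^sub>i,\<partial>\<^sub>j)\<partial>\<^sub>l = \<Sum>\<^sub>m curvature G m i j l \<partial>\<^sub>m\<close>, where
  \<open>R(X,Y) = \<nabla>\<^sub>X\<nabla>\<^sub>Y - \<nabla>\<^sub>Y\<nabla>\<^sub>X - \<nabla>\<^bsub>[X,Y]\<^esub>\<close>.\<close>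

definition curvature ::
    "('n::finite rvec \<Rightarrow> 'n rmat) \<Rightarrow> 'n \<Rightarrow> 'n \<Rightarrow> 'n \<Rightarrow> 'n \<Rightarrow> 'n rvec \<Rightarrow> real" where
  "curvature G m i j l x =
     partial i (christoffel G m j l) x - partial j (christoffel G m i l) x
     + (\<Sum>a\<in>UNIV. christoffel G m i a x * christoffel G a j l x
                  - christoffel G m j a x * christoffel G a i l x)"

text \<open>With \<open>R(x \<and> y, z \<and> w) = \<langle>R(x,y)w, z\<rangle>\<close>, the value \<open>R(x \<and> y, x \<and> y)\<close> is the sectional
  curvature for orthonormal \<open>x, y\<close>.\<close>

definition riemann :: "('n::{finite,linorder} rvec \<Rightarrow> 'n rmat) \<Rightarrow> 'n rvec \<Rightarrow> 'n dform" where
  "riemann G x = (\<chi> I J. if card I = 2 \<and> card J = 2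
      then \<Sum>m\<in>UNIV. G x $ Min J $ m * curvature G m (Min I) (Max I) (Max J) x
      else 0)"

definition hessian ::
    "('n::finite rvec \<Rightarrow> 'n rmat) \<Rightarrow> ('n rvec \<Rightarrow> real) \<Rightarrow> 'n rvec \<Rightarrow> 'n rmat" where
  "hessian G F x = (\<chi> i j.
      partial i (partial j F) x - (\<Sum>l\<in>UNIV. christoffel G l i j x * partial l F x))"

text \<open>The Einstein-Lovelock tensor \<open>T\<^sub>2\<^sub>k\<close>, for \<open>2 * k < CARD('n)\<close>.\<close>

definition einstein_lovelock ::
    "('n::{finite,linorder} rvec \<Rightarrow> 'n rmat) \<Rightarrow> nat \<Rightarrow> 'n rvec \<Rightarrow> 'n dform" where
  "einstein_lovelock G k x =
     dform_hodge (G x) (CARD('n) - 1) (CARD('n) - 1)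
       ((1 / fact (CARD('n) - 2 * k - 1)) *\<^sub>R
          dform_mult (dform_power (dform_of_matrix (G x)) (CARD('n) - 2 * k - 1))
                     (dform_power (riemann G x) k))"

definition lovelock_operator ::
    "('n::{finite,linorder} rvec \<Rightarrow> 'n rmat) \<Rightarrow> nat \<Rightarrow> ('n rvec \<Rightarrow> real) \<Rightarrow> 'n rvec \<Rightarrow> real"
where
  "lovelock_operator G k F x =
     - dform_inner11 (G x) (einstein_lovelock G k x) (dform_of_matrix (hessian G F x))"


section \<open>Riemannian manifolds\<close>

text \<open>A chart consists of its domain and its coordinate map.\<close>

type_synonym ('a, 'n) chart = "'a set \<times> ('a \<Rightarrow> 'n rvec)"

abbreviation chart_image :: "('a, 'n) chart \<Rightarrow> ('n rvec) set" where
  "chart_image c \<equiv> snd c ` fst c"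

abbreviation chart_inv :: "('a, 'n) chart \<Rightarrow> 'n rvec \<Rightarrow> 'a" where
  "chart_inv c \<equiv> inv_into (fst c) (snd c)"

abbreviation transition :: "('a, 'n) chart \<Rightarrow> ('a, 'n) chart \<Rightarrow> 'n rvec \<Rightarrow> 'n rvec" where
  "transition c d \<equiv> snd d \<circ> chart_inv c"

text \<open>Smooth manifolds without boundary; the atlas need not be maximal.\<close>

definition smooth_manifold :: "'a topology \<Rightarrow> ('a, 'n::finite) chart set \<Rightarrow> bool" where
  "smooth_manifold X A \<longleftrightarrow>
     Hausdorff_space X \<and> second_countable X \<and>
     (\<Union>c\<in>A. fst c) = topspace X \<and>
     (\<forall>c\<in>A. openin X (fst c) \<and> open (chart_image c) \<and>
        homeomorphic_map (subtopology X (fst c)) (top_of_set (chart_image c)) (snd c)) \<and>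
     (\<forall>c\<in>A. \<forall>d\<in>A. smooth_on (snd c ` (fst c \<inter> fst d)) (transition c d))"

text \<open>A metric is given by its matrix in every chart of the atlas,
  subject to the transformation law of covariant 2-tensors.\<close>

definition riemannian_metric ::
    "('a, 'n::finite) chart set \<Rightarrow> (('a, 'n) chart \<Rightarrow> 'n rvec \<Rightarrow> 'n rmat) \<Rightarrow> bool" where
  "riemannian_metric A g \<longleftrightarrow>
     (\<forall>c\<in>A. smooth_on (chart_image c) (g c) \<and>
        (\<forall>x\<in>chart_image c. transpose (g c x) = g c x \<and>
            (\<forall>v. v \<noteq> 0 \<longrightarrow> vec_inner (g c x) v v > 0))) \<and>
     (\<forall>c\<in>A. \<forall>d\<in>A. \<forall>x\<in>snd c ` (fst c \<inter> fst d).
        let J = matrix (frechet_derivative (transition c d) (at x))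
        in g c x = transpose J ** g d (transition c d x) ** J)"

definition riemannian_manifold ::
    "'a topology \<Rightarrow> ('a, 'n::finite) chart set
      \<Rightarrow> (('a, 'n) chart \<Rightarrow> 'n rvec \<Rightarrow> 'n rmat) \<Rightarrow> bool" where
  "riemannian_manifold X A g \<longleftrightarrow> smooth_manifold X A \<and> riemannian_metric A g"

definition smooth_function :: "('a, 'n::finite) chart set \<Rightarrow> ('a \<Rightarrow> real) \<Rightarrow> bool" where
  "smooth_function A f \<longleftrightarrow> (\<forall>c\<in>A. smooth_on (chart_image c) (f \<circ> chart_inv c))"

text \<open>The following conditions on tensor fields do not depend on coordinates, so
  imposing them in every chart of the atlas is the same as imposing them at every point.\<close>

definition lovelock_pos_def ::
    "('a, 'n::{finite,linorder}) chart set \<Rightarrow> (('a, 'n) chart \<Rightarrow> 'n rvec \<Rightarrow> 'n rmat)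
      \<Rightarrow> nat \<Rightarrow> bool" where
  "lovelock_pos_def A g k \<longleftrightarrow>
     (\<forall>c\<in>A. \<forall>x\<in>chart_image c. pos_def11 (einstein_lovelock (g c) k x))"

definition lovelock_neg_def ::
    "('a, 'n::{finite,linorder}) chart set \<Rightarrow> (('a, 'n) chart \<Rightarrow> 'n rvec \<Rightarrow> 'n rmat)
      \<Rightarrow> nat \<Rightarrow> bool" where
  "lovelock_neg_def A g k \<longleftrightarrow>
     (\<forall>c\<in>A. \<forall>x\<in>chart_image c. neg_def11 (einstein_lovelock (g c) k x))"

definition lovelock_harmonic ::
    "('a, 'n::{finite,linorder}) chart set \<Rightarrow> (('a, 'n) chart \<Rightarrow> 'n rvec \<Rightarrow> 'n rmat)
      \<Rightarrow> nat \<Rightarrow> ('a \<Rightarrow> real) \<Rightarrow> bool" where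
  "lovelock_harmonic A g k f \<longleftrightarrow>
     (\<forall>c\<in>A. \<forall>x\<in>chart_image c. lovelock_operator (g c) k (f \<circ> chart_inv c) x = 0)"

end

(* In a chart, l_2k(f) = 0 is a second order equation a^ij (d_i d_j f - Gamma^l_ij d_l f) = 0 without
   zeroth order term, where a = G^-1 T_2k G^-1. If T_2k is definite, the equation is elliptic with
   continuous coefficients, so Hopf's strong maximum principle applies: the set where f
   attains its maximum, nonempty by compactness, is open and closed. *)
theory Submission
  imports Defs
begin

text \<open>The operator is defined through an arbitrarily chosen orthonormal frame, with no
  continuity in the point. Summing over the frame turns its vectors into entries of the inverse
  metric: this removes the choice and produces the two factors G^-1 of the coefficient matrix.
  Continuity is essential because definiteness is assumed only pointwise. The positive lower bound
  that Hopf's argument needs on a small closed ball is the minimum of a continuous function on a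
  compact set, so the continuity of T_2k has to be followed through the inverse metric, the
  curvature and the Hodge star. At an interior maximum, the coefficient matrix is paired with the
  Hessian through a Gram decomposition of minus the Hessian; the symmetry behind it is that of mixed
  partial derivatives.\<close>

section \<open>Positive definite matrices\<close>

text \<open>Symmetric Gaussian elimination: subtracting the rank one matrix
  \<open>a m i * a m j / a m m\<close> leaves a Schur complement that is positive semidefinite on
  the remaining indices. An arbitrary finite index set makes the induction possible.\<close>

lemma psd_decomposition_on:
  fixes a :: "'i \<Rightarrow> 'i \<Rightarrow> real"
  assumes "finite I"
    and "\<And>i j. i \<in> I \<Longrightarrow> j \<in> I \<Longrightarrow> a i j = a j i"
    and "\<And>c. 0 \<le> (\<Sum>i\<in>I. \<Sum>j\<in>I. a i j * c i * c j)"
  shows "\<exists>w. \<forall>i\<in>I. \<forall>j\<in>I. a i j = (\<Sum>k\<in>I. w k i * w k j)"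
  using assms
proof (induction I arbitrary: a rule: finite_induct)
  case empty
  then show ?case by simp
next
  case (insert m I)
  note sym = insert.prems(1)
  \<comment> \<open>The form at a vector whose entry t at m is free, so that t can be chosen to
    advantage below.\<close>
  have quad: "0 \<le> a m m * t\<^sup>2 + 2 * t * (\<Sum>j\<in>I. a m j * c j) + (\<Sum>i\<in>I. \<Sum>j\<in>I. a i j * c i * c j)"
    for c t
  proof -
    let ?c = "c(m := t)"
    have c: "?c j = c j" if "j \<in> I" for j
      using that insert.hyps by auto
    have split: "(\<Sum>i\<in>insert m I. \<Sum>j\<in>insert m I. F i j) = F m m + (\<Sum>j\<in>I. F m j)
        + ((\<Sum>i\<in>I. F i m) + (\<Sum>i\<in>I. \<Sum>j\<in>I. F i j))" for F :: "'i \<Rightarrow> 'i \<Rightarrow> real"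
      using insert.hyps by (simp add: sum.distrib)
    have "0 \<le> (\<Sum>i\<in>insert m I. \<Sum>j\<in>insert m I. a i j * ?c i * ?c j)"
      by (rule insert.prems(2))
    also have "\<dots> = a m m * t * t + (\<Sum>j\<in>I. a m j * t * c j)
        + ((\<Sum>i\<in>I. a i m * c i * t) + (\<Sum>i\<in>I. \<Sum>j\<in>I. a i j * c i * c j))"
      unfolding split by (intro arg_cong2[where f = "(+)"] sum.cong refl)
        (simp_all add: c del: fun_upd_apply, simp_all)
    also have "(\<Sum>i\<in>I. a i m * c i * t) = (\<Sum>j\<in>I. a m j * t * c j)"
      using sym by (intro sum.cong) auto
    also have "(\<Sum>j\<in>I. a m j * t * c j) = t * (\<Sum>j\<in>I. a m j * c j)"
      by (simp add: sum_distrib_left mult_ac)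
    finally show ?thesis by (simp add: power2_eq_square algebra_simps)
  qed
  have mm: "0 \<le> a m m"
    using quad[of 1 "\<lambda>_. 0"] by simp
  have mi: "a m i = 0" if "a m m = 0" "i \<in> I" for i
  proof (rule ccontr)
    assume ne: "a m i \<noteq> 0"
    \<comment> \<open>Chosen so that \<open>2 * t * a m i + a i i\<close> equals -1.\<close>
    define t where "t = - (a i i + 1) / (2 * a m i)"
    define d where "d j = (if j = i then 1 else 0 :: real)" for j
    have d: "(\<Sum>j\<in>I. F j * d j) = F i" for F
      using that insert.hyps by (simp add: d_def if_distrib[of "(*) _"] cong: if_cong)
    have "2 * t * a m i = - (a i i + 1)"
      using ne by (simp add: t_def)
    moreover have "0 \<le> 2 * t * a m i + a i i"
      using quad[of t d] unfolding d that(1) by simp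
    ultimately show False by linarith
  qed
  \<comment> \<open>If \<open>a m m = 0\<close>, then row \<open>m\<close> vanishes and the quotients below are \<open>0\<close>.\<close>
  define b where "b i j = a i j - a m i * a m j / a m m" for i j
  have "0 \<le> (\<Sum>i\<in>I. \<Sum>j\<in>I. b i j * c i * c j)" for c
  proof -
    let ?s = "\<Sum>j\<in>I. a m j * c j"
    have "(\<Sum>i\<in>I. \<Sum>j\<in>I. b i j * c i * c j)
        = (\<Sum>i\<in>I. \<Sum>j\<in>I. a i j * c i * c j - (a m i * c i) * (a m j * c j) / a m m)"
      by (intro sum.cong refl) (simp add: b_def algebra_simps)
    also have "\<dots> = (\<Sum>i\<in>I. \<Sum>j\<in>I. a i j * c i * c j) - ?s * ?s / a m m"
      by (simp add: sum_subtractf sum_product flip: sum_divide_distrib)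
    finally have "(\<Sum>i\<in>I. \<Sum>j\<in>I. b i j * c i * c j)
        = (\<Sum>i\<in>I. \<Sum>j\<in>I. a i j * c i * c j) - ?s * ?s / a m m" .
    \<comment> \<open>For \<open>a m m > 0\<close>, this t minimizes the quadratic in t, and the
      minimum is the form of the Schur complement.\<close>
    moreover have "a m m * (- ?s / a m m)\<^sup>2 + 2 * (- ?s / a m m) * ?s = - (?s * ?s / a m m)"
      by (cases "a m m = 0") (simp_all add: field_simps power2_eq_square)
    ultimately show ?thesis
      using quad[of "- ?s / a m m" c] by linarith
  qed
  moreover have "b i j = b j i" if "i \<in> I" "j \<in> I" for i j
    using sym that by (simp add: b_def)
  ultimately obtain w where w: "\<And>i j. i \<in> I \<Longrightarrow> j \<in> I \<Longrightarrow> b i j = (\<Sum>k\<in>I. w k i * w k j)"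
    using insert.IH[of b] by blast
  \<comment> \<open>Row m reproduces the subtracted rank one matrix. The other rows are set to zero
    in column m, where that matrix alone already gives the entries of a.\<close>
  define w' where
    "w' k i = (if k = m then a m i / sqrt (a m m) else if i = m then 0 else w k i)" for k i
  have "a i j = (\<Sum>k\<in>insert m I. w' k i * w' k j)" if i: "i \<in> insert m I" and j: "j \<in> insert m I" for i j
  proof -
    have "(\<Sum>k\<in>insert m I. w' k i * w' k j)
        = a m i * a m j / a m m + (\<Sum>k\<in>I. if i = m \<or> j = m then 0 else w k i * w k j)"
      using insert.hyps mm
      by (simp add: w'_def) (auto intro!: sum.cong)
    moreover have "a i j = a m i * a m j / a m m" if "i = m \<or> j = m"
      using that i j mi sym by (cases "a m m = 0") auto
    moreover have "a i j - a m i * a m j / a m m = (\<Sum>k\<in>I. w k i * w k j)" if "i \<noteq> m" "j \<noteq> m"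
      using w[of i j] i j that by (simp add: b_def)
    ultimately show ?thesis by (cases "i = m \<or> j = m") auto
  qed
  then show ?case by blast
qed

lemma inner_matrix_vector_eq_sum:
  fixes A :: "real^'n^'n"
  shows "u \<bullet> (A *v v) = (\<Sum>i\<in>UNIV. \<Sum>j\<in>UNIV. A $ i $ j * u $ i * v $ j)"
  by (simp add: inner_vec_def matrix_vector_mult_def sum_distrib_left mult_ac)

lemma psd_imp_transpose_mult:
  fixes A :: "real^'n^'n"
  assumes "transpose A = A" and "\<And>v. 0 \<le> v \<bullet> (A *v v)"
  obtains W :: "real^'n^'n" where "A = transpose W ** W"
proof -
  have sym: "A $ i $ j = A $ j $ i" for i j
    using arg_cong[OF assms(1), of "\<lambda>M. M $ j $ i"] by (simp add: transpose_def)
  have "0 \<le> (\<Sum>i\<in>UNIV. \<Sum>j\<in>UNIV. A $ i $ j * c i * c j)" for c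
    using assms(2)[of "vec_lambda c"] by (simp add: inner_matrix_vector_eq_sum)
  then have "\<exists>w. \<forall>i\<in>UNIV. \<forall>j\<in>UNIV. A $ i $ j = (\<Sum>k\<in>(UNIV :: 'n set). w k i * w k j)"
    by (intro psd_decomposition_on finite_class.finite_UNIV sym)
  then obtain w :: "'n \<Rightarrow> 'n \<Rightarrow> real"
    where "\<And>i j. A $ i $ j = (\<Sum>k\<in>UNIV. w k i * w k j)"
    by blast
  then have "A $ i $ j = (transpose (\<chi> k i. w k i) ** (\<chi> k i. w k i)) $ i $ j" for i j
    by (simp add: matrix_matrix_mult_def transpose_def)
  then have "A = transpose (\<chi> k i. w k i) ** (\<chi> k i. w k i)"
    unfolding vec_eq_iff by blast
  then show ?thesis by (rule that)
qed

text \<open>With - H = W^T W, pairing P with - H gives the sum of the quadratic form of P over the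
  rows of W. Decomposing H rather than P lets P be any matrix with nonnegative quadratic
  form.\<close>

lemma sum_mult_psd_nsd_nonpos:
  fixes P H :: "real^'n^'n"
  assumes P: "\<And>v. 0 \<le> v \<bullet> (P *v v)"
    and sym: "transpose H = H" and H: "\<And>v. v \<bullet> (H *v v) \<le> 0"
  shows "(\<Sum>i\<in>UNIV. \<Sum>j\<in>UNIV. P $ i $ j * H $ i $ j) \<le> 0"
proof -
  have "transpose (- H) = - H"
    using sym by (simp add: vec_eq_iff transpose_def)
  moreover have "0 \<le> v \<bullet> (- H *v v)" for v
    using H[of v] by (simp add: inner_matrix_vector_eq_sum sum_negf)
  ultimately obtain W :: "real^'n^'n" where "- H = transpose W ** W"
    by (rule psd_imp_transpose_mult)
  then have *: "- (H $ i $ j) = (\<Sum>k\<in>UNIV. W $ k $ i * W $ k $ j)" for i j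
    by (simp add: vec_eq_iff matrix_matrix_mult_def transpose_def)
  have "- (\<Sum>i\<in>UNIV. \<Sum>j\<in>UNIV. P $ i $ j * H $ i $ j)
      = (\<Sum>i\<in>UNIV. \<Sum>j\<in>UNIV. P $ i $ j * (- (H $ i $ j)))"
    by (simp add: sum_negf)
  also have "\<dots> = (\<Sum>i\<in>UNIV. \<Sum>j\<in>UNIV. \<Sum>k\<in>UNIV. P $ i $ j * W $ k $ i * W $ k $ j)"
    unfolding * by (simp add: sum_distrib_left mult_ac)
  also have "\<dots> = (\<Sum>i\<in>UNIV. \<Sum>k\<in>UNIV. \<Sum>j\<in>UNIV. P $ i $ j * W $ k $ i * W $ k $ j)"
    by (intro sum.cong refl sum.swap)
  also have "\<dots> = (\<Sum>k\<in>UNIV. W $ k \<bullet> (P *v W $ k))"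
    unfolding inner_matrix_vector_eq_sum by (rule sum.swap)
  also have "\<dots> \<ge> 0" by (intro sum_nonneg P)
  finally show ?thesis by simp
qed

lemma posdef_imp_invertible:
  fixes A :: "real^'n^'n"
  assumes "\<And>v. v \<noteq> 0 \<Longrightarrow> 0 < v \<bullet> (A *v v)"
  shows "invertible A"
proof -
  have "v = 0" if "A *v v = 0" for v
    using assms[of v] that by fastforce
  then show ?thesis
    using invertible_left_inverse matrix_left_invertible_ker by blast
qed

text \<open>A Gram decomposition gives det A = (det W)^2, and invertibility excludes zero.\<close>

lemma posdef_det_pos:
  fixes A :: "real^'n^'n"
  assumes sym: "transpose A = A" and pos: "\<And>v. v \<noteq> 0 \<Longrightarrow> 0 < v \<bullet> (A *v v)"
  shows "0 < det A"
proof -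
  have "0 \<le> v \<bullet> (A *v v)" for v
    using pos[of v] by (cases "v = 0") auto
  then obtain W :: "real^'n^'n" where W: "A = transpose W ** W"
    using psd_imp_transpose_mult[OF sym] by blast
  have "det A \<noteq> 0"
    using posdef_imp_invertible[OF pos] by (simp add: invertible_det_nz)
  then show ?thesis
    by (auto simp: W det_mul det_transpose zero_less_mult_iff linorder_neq_iff)
qed

section \<open>Orthonormal frames and the inverse of the metric\<close>

lemma orthonormal_frame_exists:
  fixes G :: "real^'n^'n"
  assumes sym: "transpose G = G" and pos: "\<And>v. v \<noteq> 0 \<Longrightarrow> 0 < v \<bullet> (G *v v)"
  shows "\<exists>e. orthonormal_frame G e"
proof -
  have "0 \<le> v \<bullet> (G *v v)" for v
    using pos[of v] by (cases "v = 0") auto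
  then obtain W :: "real^'n^'n" where W: "G = transpose W ** W"
    using psd_imp_transpose_mult[OF sym] by blast
  have "det W \<noteq> 0"
    using posdef_det_pos[OF sym pos] by (auto simp: W det_mul)
  \<comment> \<open>W carries the scalar product of G to the Euclidean one, so the columns of its
    inverse, which W sends to the standard basis, form a frame.\<close>
  then obtain E :: "real^'n^'n" where E: "W ** E = mat 1"
    using invertible_det_nz invertible_right_inverse by blast
  have "vec_inner G (column i E) (column j E) = (if i = j then 1 else 0)" for i j
  proof -
    have *: "W *v column i E = axis i 1" for i
      using E by (metis matrix_vector_mul_assoc matrix_vector_mul_lid matrix_vector_mult_basis)
    have "vec_inner G (column i E) (column j E) = (W *v column j E) \<bullet> (W *v column i E)"
      unfolding vec_inner_def W
      by (metis dot_lmul_matrix inner_commute matrix_vector_mul_assoc transpose_matrix_vector)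
    then show ?thesis by (auto simp: * inner_axis_axis)
  qed
  then show ?thesis
    unfolding orthonormal_frame_def by (intro exI[of _ "\<lambda>i. column i E"]) simp
qed

lemma matrix_inv_unique:
  fixes A :: "real^'n^'m"
  assumes "A ** B = mat 1" "B ** A = mat 1"
  shows "matrix_inv A = B"
proof -
  have "A ** matrix_inv A = mat 1 \<and> matrix_inv A ** A = mat 1"
    unfolding matrix_inv_def by (rule someI[of _ B]) (use assms in blast)
  then show ?thesis
    by (metis assms(1) matrix_mul_assoc matrix_mul_lid matrix_mul_rid)
qed

text \<open>For the matrix E with columns \<open>e i\<close>, orthonormality reads E^T G E = 1,
  hence G^-1 = E E^T, the same for every frame.\<close>

lemma matrix_inv_eq_sum_frame:
  fixes G :: "real^'n^'n"
  assumes "orthonormal_frame G e"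
  shows "matrix_inv G $ a $ b = (\<Sum>i\<in>UNIV. e i $ a * e i $ b)"
proof -
  define E where "E = (\<chi> a i. e i $ a)"
  have col: "column i E = e i" for i
    by (simp add: E_def column_def vec_eq_iff)
  have "column i (transpose E ** (G ** E)) = transpose E *v (G *v e i)" for i
    by (metis col matrix_vector_mul_assoc matrix_vector_mult_basis)
  moreover have "(transpose E *v w) $ j = e j \<bullet> w" for w j
    by (simp add: E_def transpose_def inner_vec_def matrix_vector_mult_def)
  ultimately have "column i (transpose E ** (G ** E)) $ j = e j \<bullet> (G *v e i)" for i j
    by simp
  then have "(transpose E ** (G ** E)) $ j $ i = e j \<bullet> (G *v e i)" for i j
    by (simp add: column_def)
  then have "transpose E ** (G ** E) = mat 1"
    using assms by (simp add: vec_eq_iff mat_def orthonormal_frame_def vec_inner_def)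
  then have "(transpose E ** G) ** E = mat 1"
    by (simp only: matrix_mul_assoc)
  then have "E ** (transpose E ** G) = mat 1"
    by (rule matrix_left_right_inverse[THEN iffD1])
  then have inv: "(E ** transpose E) ** G = mat 1"
    by (simp only: matrix_mul_assoc)
  then have "G ** (E ** transpose E) = mat 1"
    by (rule matrix_left_right_inverse[THEN iffD1])
  then have "matrix_inv G = E ** transpose E"
    using inv by (rule matrix_inv_unique)
  then show ?thesis
    by (simp add: matrix_matrix_mult_def E_def transpose_def)
qed

section \<open>Functions of class \<open>C\<^sup>k\<close>\<close>

lemma Ck_on_SucD:
  assumes "Ck_on (Suc k) S f"
  shows "x \<in> S \<Longrightarrow> (f has_derivative frechet_derivative f (at x)) (at x)"
    and "Ck_on k S (\<lambda>x. frechet_derivative f (at x) v)"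
  using assms by (auto simp: frechet_derivative_works)

text \<open>An open S is a neighbourhood of each of its points, so f and g share their derivatives
  on S, and the argument repeats at higher orders.\<close>

lemma Ck_on_cong:
  assumes "open S" and "Ck_on k S f" and "\<And>x. x \<in> S \<Longrightarrow> f x = g x"
  shows "Ck_on k S g"
  using assms(2,3)
proof (induction k arbitrary: f g)
  case 0
  then show ?case by (simp cong: continuous_on_cong)
next
  case (Suc k)
  have g: "(g has_derivative frechet_derivative f (at x)) (at x)" if "x \<in> S" for x
    using has_derivative_transform_within_open[OF Ck_on_SucD(1)[OF Suc.prems(1) that] \<open>open S\<close> that]
      Suc.prems(2) by blast
  then have eq: "frechet_derivative f (at x) = frechet_derivative g (at x)" if "x \<in> S" for x
    using that by (blast intro: frechet_derivative_at)
  have "Ck_on k S (\<lambda>x. frechet_derivative g (at x) v)" for v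
    by (rule Suc.IH[OF Ck_on_SucD(2)[OF Suc.prems(1), of v]]) (simp add: eq)
  then show ?case
    using g by (auto simp: differentiable_def)
qed

text \<open>Lets a derivative computed by the usual rules stand in for
  \<open>frechet_derivative\<close>; the closure properties below then become inductions on
  k.\<close>

lemma Ck_on_SucI:
  assumes "open S" and f: "\<And>x. x \<in> S \<Longrightarrow> (f has_derivative f' x) (at x)"
    and "\<And>v. Ck_on k S (\<lambda>x. f' x v)"
  shows "Ck_on (Suc k) S f"
proof -
  have "f' x = frechet_derivative f (at x)" if "x \<in> S" for x
    using f[OF that] by (rule frechet_derivative_at)
  then have "Ck_on k S (\<lambda>x. frechet_derivative f (at x) v)" for v
    by (intro Ck_on_cong[OF assms(1) assms(3)[of v]]) simp
  then show ?thesis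
    using f by (auto simp: differentiable_def)
qed

lemma Ck_on_Suc_imp_Ck_on: "Ck_on (Suc k) S f \<Longrightarrow> Ck_on k S f"
proof (induction k arbitrary: f)
  case 0
  then show ?case
    by (auto intro!: continuous_at_imp_continuous_on differentiable_imp_continuous_within)
next
  case (Suc k)
  then show ?case by (metis Ck_on.simps(2))
qed

lemma Ck_on_imp_continuous_on: "Ck_on k S f \<Longrightarrow> continuous_on S f"
  by (induction k) (simp, blast dest: Ck_on_Suc_imp_Ck_on)

lemma Ck_on_const: "open S \<Longrightarrow> Ck_on k S (\<lambda>x. c)"
proof (induction k arbitrary: c)
  case (Suc k)
  show ?case
    by (rule Ck_on_SucI[where f' = "\<lambda>_ _. 0", OF Suc.prems]) (simp_all add: Suc)
qed simp

lemma Ck_on_bounded_linear: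
  assumes "open S" and L: "bounded_linear L" and "Ck_on k S f"
  shows "Ck_on k S (\<lambda>x. L (f x))"
  using assms(3)
proof (induction k arbitrary: f)
  case 0
  then show ?case using bounded_linear.continuous_on[OF L] by simp
next
  case (Suc k)
  show ?case
    by (rule Ck_on_SucI[OF assms(1) bounded_linear.has_derivative[OF L Ck_on_SucD(1)[OF Suc.prems]]])
      (auto intro: Suc.IH Ck_on_SucD(2)[OF Suc.prems])
qed

lemma Ck_on_add:
  assumes "open S" and "Ck_on k S f" and "Ck_on k S g"
  shows "Ck_on k S (\<lambda>x. f x + g x)"
  using assms(2,3)
proof (induction k arbitrary: f g)
  case 0
  then show ?case by (simp add: continuous_on_add)
next
  case (Suc k)
  show ?case
    by (rule Ck_on_SucI[OF assms(1)
          has_derivative_add[OF Ck_on_SucD(1)[OF Suc.prems(1)] Ck_on_SucD(1)[OF Suc.prems(2)]]])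
      (auto intro!: Suc.IH Ck_on_SucD(2)[OF Suc.prems(1)] Ck_on_SucD(2)[OF Suc.prems(2)])
qed

lemma Ck_on_mult:
  fixes f g :: "'a::real_normed_vector \<Rightarrow> real"
  assumes "open S" and "Ck_on k S f" and "Ck_on k S g"
  shows "Ck_on k S (\<lambda>x. f x * g x)"
  using assms(2,3)
proof (induction k arbitrary: f g)
  case 0
  then show ?case by (simp add: continuous_on_mult)
next
  case (Suc k)
  show ?case
    by (rule Ck_on_SucI[OF assms(1)
          has_derivative_mult[OF Ck_on_SucD(1)[OF Suc.prems(1)] Ck_on_SucD(1)[OF Suc.prems(2)]]])
      (auto intro!: Ck_on_add[OF assms(1)] Suc.IH Ck_on_SucD(2)[OF Suc.prems(1)]
        Ck_on_SucD(2)[OF Suc.prems(2)] Suc.prems[THEN Ck_on_Suc_imp_Ck_on])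
qed

lemma Ck_on_inverse:
  fixes f :: "'a::real_normed_vector \<Rightarrow> real"
  assumes "open S" and "Ck_on k S f" and nz: "\<And>x. x \<in> S \<Longrightarrow> f x \<noteq> 0"
  shows "Ck_on k S (\<lambda>x. inverse (f x))"
  using assms(2)
proof (induction k)
  case 0
  then show ?case using nz by (simp add: continuous_on_inverse)
next
  case (Suc k)
  note inv = Suc.IH[OF Suc.prems[THEN Ck_on_Suc_imp_Ck_on]]
  have "Ck_on k S (\<lambda>x. (- 1) * (inverse (f x) * frechet_derivative f (at x) v * inverse (f x)))" for v
    by (intro Ck_on_mult[OF assms(1)] Ck_on_const[OF assms(1)] inv Ck_on_SucD(2)[OF Suc.prems])
  then show ?case
    by (intro Ck_on_SucI[OF assms(1) Deriv.has_derivative_inverse[OF nz Ck_on_SucD(1)[OF Suc.prems]]])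
      simp_all
qed

lemma Ck_on_diff:
  fixes f g :: "'a::real_normed_vector \<Rightarrow> real"
  assumes "open S" and "Ck_on k S f" and "Ck_on k S g"
  shows "Ck_on k S (\<lambda>x. f x - g x)"
  using Ck_on_add[OF assms(1,2) Ck_on_mult[OF assms(1) Ck_on_const[OF assms(1), of k "- 1"] assms(3)]]
  by simp

lemma Ck_on_sum:
  assumes "open S" and "\<And>i. i \<in> I \<Longrightarrow> Ck_on k S (f i)"
  shows "Ck_on k S (\<lambda>x. \<Sum>i\<in>I. f i x)"
  using assms(2)
  by (induction I rule: infinite_finite_induct)
    (auto intro: Ck_on_const[OF assms(1)] Ck_on_add[OF assms(1)])

lemma Ck_on_prod:
  fixes f :: "'i \<Rightarrow> 'a::real_normed_vector \<Rightarrow> real"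
  assumes "open S" and "\<And>i. i \<in> I \<Longrightarrow> Ck_on k S (f i)"
  shows "Ck_on k S (\<lambda>x. \<Prod>i\<in>I. f i x)"
  using assms(2)
  by (induction I rule: infinite_finite_induct)
    (auto intro: Ck_on_const[OF assms(1)] Ck_on_mult[OF assms(1)])

lemma Ck_on_vec_nth: "open S \<Longrightarrow> Ck_on k S f \<Longrightarrow> Ck_on k S (\<lambda>x. f x $ i)"
  by (rule Ck_on_bounded_linear) (auto intro: bounded_linear_vec_nth)

lemma Ck_on_partial: "Ck_on (Suc k) S F \<Longrightarrow> Ck_on k S (partial i F)"
  using Ck_on_SucD(2)[of k S F "axis i 1"] by (simp add: partial_def[abs_def])

lemma Ck_on_det:
  fixes M :: "'a::real_normed_vector \<Rightarrow> real^'n^'n"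
  assumes "open S" and "\<And>i j. Ck_on k S (\<lambda>x. M x $ i $ j)"
  shows "Ck_on k S (\<lambda>x. det (M x))"
  unfolding det_def
  by (intro Ck_on_sum Ck_on_mult Ck_on_prod Ck_on_const assms)

section \<open>Regularity of the inverse matrix\<close>

lemma matrix_mul_matrix_inv:
  fixes A :: "real^'n^'n"
  assumes "det A \<noteq> 0"
  shows "A ** matrix_inv A = mat 1"
proof -
  have "invertible A" using assms by (simp add: invertible_det_nz)
  then show ?thesis
    unfolding invertible_def matrix_inv_def by (rule someI2_ex) simp
qed

text \<open>Column m of the inverse solves A x = e_m. Written as a quotient of polynomials in the
  entries, the inverse inherits their regularity.\<close>

lemma matrix_inv_nth_cramer:
  fixes A :: "real^'n^'n"
  assumes "det A \<noteq> 0"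
  shows "matrix_inv A $ l $ m
    = det (\<chi> i j. if j = l then axis m 1 $ i else A $ i $ j) * inverse (det A)"
proof -
  have "A ** matrix_inv A = mat 1"
    using assms by (rule matrix_mul_matrix_inv)
  then have "A *v column m (matrix_inv A) = axis m 1"
    by (metis matrix_vector_mul_assoc matrix_vector_mul_lid matrix_vector_mult_basis)
  then have "column m (matrix_inv A) $ l
      = det (\<chi> i j. if j = l then axis m 1 $ i else A $ i $ j) / det A"
    by (simp add: cramer[OF assms])
  then show ?thesis by (simp add: column_def divide_inverse)
qed

lemma Ck_on_matrix_inv:
  fixes M :: "'a::real_normed_vector \<Rightarrow> real^'n^'n"
  assumes "open S" and M: "\<And>i j. Ck_on k S (\<lambda>x. M x $ i $ j)"
    and nz: "\<And>x. x \<in> S \<Longrightarrow> det (M x) \<noteq> 0"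
  shows "Ck_on k S (\<lambda>x. matrix_inv (M x) $ l $ m)"
proof (rule Ck_on_cong[OF assms(1)])
  have "Ck_on k S (\<lambda>x. (\<chi> i j. if j = l then axis m 1 $ i else M x $ i $ j) $ i $ j)" for i j
    by (cases "j = l") (simp_all add: M Ck_on_const[OF assms(1)])
  then show "Ck_on k S (\<lambda>x. det (\<chi> i j. if j = l then axis m 1 $ i else M x $ i $ j) * inverse (det (M x)))"
    by (intro Ck_on_mult Ck_on_inverse Ck_on_det assms)
qed (simp add: matrix_inv_nth_cramer nz)

section \<open>Symmetry of second derivatives\<close>

lemma has_derivative_imp_DERIV_line:
  assumes "(u has_derivative D) (at (a + r *\<^sub>R v))"
  shows "((\<lambda>r. u (a + r *\<^sub>R v)) has_real_derivative D v) (at r)"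
proof -
  interpret D: bounded_linear D using assms by (rule has_derivative_bounded_linear)
  have "((\<lambda>r. a + r *\<^sub>R v) has_derivative (\<lambda>h. h *\<^sub>R v)) (at r)"
    by (auto intro!: derivative_eq_intros)
  from has_derivative_compose[OF this assms] show ?thesis
    by (simp add: has_field_derivative_def D.scaleR mult.commute[of _ "D v"])
qed

text \<open>The mean value theorem along v and then along w turns the quotient into the second
  derivative at a point of the parallelogram, which tends to x. The quotient is symmetric in v and
  w, so exchanging them shows that the order of differentiation does not matter.\<close>

lemma second_difference_tendsto:
  fixes u :: "'a::real_normed_vector \<Rightarrow> real"
  assumes S: "open S" "x \<in> S" and u: "Ck_on (Suc (Suc 0)) S u"
  shows "((\<lambda>t. (u (x + t *\<^sub>R v + t *\<^sub>R w) - u (x + t *\<^sub>R v) - u (x + t *\<^sub>R w) + u x) / t\<^sup>2)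
    \<longlongrightarrow> frechet_derivative (\<lambda>y. frechet_derivative u (at y) v) (at x) w) (at_right 0)"
proof (rule tendstoI)
  define Dv where "Dv y = frechet_derivative u (at y) v" for y
  define Dwv where "Dwv y = frechet_derivative Dv (at y) w" for y
  have Dv: "Ck_on (Suc 0) S Dv"
    unfolding Dv_def using u by (rule Ck_on_SucD)
  have cont: "continuous_on S Dwv"
    using Ck_on_SucD(2)[OF Dv] by (simp add: Dwv_def)
  fix e :: real assume "e > 0"
  obtain d1 where d1: "d1 > 0" "ball x d1 \<subseteq> S"
    using S open_contains_ball by blast
  obtain d2 where d2: "d2 > 0" "\<And>y. y \<in> S \<Longrightarrow> dist y x < d2 \<Longrightarrow> dist (Dwv y) (Dwv x) < e"
    using cont \<open>x \<in> S\<close> \<open>e > 0\<close> unfolding continuous_on_iff by blast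
  \<comment> \<open>Keeps the parallelogram spanned by t v and t w inside S and within the
    continuity radius d2; the summand 1 covers v = w = 0.\<close>
  define d where "d = min d1 d2 / (norm v + norm w + 1)"
  have "d > 0" using d1 d2 by (simp add: d_def add_nonneg_pos)
  have near: "x + r *\<^sub>R v + s *\<^sub>R w \<in> S \<and> dist (x + r *\<^sub>R v + s *\<^sub>R w) x < d2"
    if "0 \<le> r" "r \<le> t" "0 \<le> s" "s \<le> t" "t < d" for r s t
  proof -
    have "dist (x + r *\<^sub>R v + s *\<^sub>R w) x = norm (r *\<^sub>R v + s *\<^sub>R w)"
      by (simp add: dist_norm algebra_simps)
    also have "\<dots> \<le> r * norm v + s * norm w"
      using that by (intro norm_triangle_le) simp
    also have "\<dots> \<le> t * norm v + t * norm w"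
      using that by (intro add_mono mult_right_mono) auto
    also have "\<dots> \<le> t * (norm v + norm w + 1)"
      using that by (simp add: algebra_simps)
    also have "\<dots> < d * (norm v + norm w + 1)"
      using that by (intro mult_strict_right_mono) (auto simp: add_nonneg_pos)
    also have "\<dots> = min d1 d2"
      using norm_ge_zero[of v] norm_ge_zero[of w] unfolding d_def
      by (metis add_nonneg_eq_0_iff add_nonneg_nonneg nonzero_divide_eq_eq zero_le_one zero_neq_one)
    finally have *: "dist (x + r *\<^sub>R v + s *\<^sub>R w) x < min d1 d2" .
    then have "x + r *\<^sub>R v + s *\<^sub>R w \<in> ball x d1" by (simp add: dist_commute)
    then show ?thesis using d1(2) * by auto
  qed
  have "dist ((u (x + t *\<^sub>R v + t *\<^sub>R w) - u (x + t *\<^sub>R v) - u (x + t *\<^sub>R w) + u x) / t\<^sup>2) (Dwv x) < e"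
    if t: "0 < t" "t < d" for t
  proof -
    have "((\<lambda>r. u (x + s *\<^sub>R w + r *\<^sub>R v)) has_real_derivative Dv (x + s *\<^sub>R w + r *\<^sub>R v)) (at r)"
      if "0 \<le> r" "r \<le> t" "0 \<le> s" "s \<le> t" for r s
      unfolding Dv_def
      by (rule has_derivative_imp_DERIV_line, rule Ck_on_SucD(1)[OF u])
        (use near[of r t s] that t in \<open>simp add: add_ac\<close>)
    \<comment> \<open>Mean value theorem in direction v for the difference of u along two parallel
      segments offset by t w.\<close>
    from this[where s = t] this[where s = 0]
    have "((\<lambda>r. u (x + t *\<^sub>R w + r *\<^sub>R v) - u (x + r *\<^sub>R v)) has_real_derivative
        Dv (x + t *\<^sub>R w + r *\<^sub>R v) - Dv (x + r *\<^sub>R v)) (at r)" if "0 \<le> r" "r \<le> t" for r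
      using that t by (intro DERIV_diff) auto
    from MVT2[OF t(1) this] obtain r where r: "0 < r" "r < t" and 1:
      "u (x + t *\<^sub>R w + t *\<^sub>R v) - u (x + t *\<^sub>R v) - (u (x + t *\<^sub>R w) - u x)
        = t * (Dv (x + t *\<^sub>R w + r *\<^sub>R v) - Dv (x + r *\<^sub>R v))"
      by auto
    have "((\<lambda>s. Dv (x + r *\<^sub>R v + s *\<^sub>R w)) has_real_derivative Dwv (x + r *\<^sub>R v + s *\<^sub>R w)) (at s)"
      if "0 \<le> s" "s \<le> t" for s
      unfolding Dwv_def
      by (rule has_derivative_imp_DERIV_line, rule Ck_on_SucD(1)[OF Dv])
        (use near[of r t s] that t r in simp)
    from MVT2[OF t(1) this] obtain s where s: "0 < s" "s < t" and 2:
      "Dv (x + r *\<^sub>R v + t *\<^sub>R w) - Dv (x + r *\<^sub>R v) = t * Dwv (x + r *\<^sub>R v + s *\<^sub>R w)"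
      by auto
    have "u (x + t *\<^sub>R v + t *\<^sub>R w) - u (x + t *\<^sub>R v) - u (x + t *\<^sub>R w) + u x
        = t * (t * Dwv (x + r *\<^sub>R v + s *\<^sub>R w))"
      using 1 2 by (simp add: add_ac)
    then have "(u (x + t *\<^sub>R v + t *\<^sub>R w) - u (x + t *\<^sub>R v) - u (x + t *\<^sub>R w) + u x) / t\<^sup>2
        = Dwv (x + r *\<^sub>R v + s *\<^sub>R w)"
      using t by (simp add: power2_eq_square)
    then show ?thesis
      using d2(2) near[of r t s] r s t by simp
  qed
  then show "\<forall>\<^sub>F t in at_right 0.
      dist ((u (x + t *\<^sub>R v + t *\<^sub>R w) - u (x + t *\<^sub>R v) - u (x + t *\<^sub>R w) + u x) / t\<^sup>2)
        (frechet_derivative (\<lambda>y. frechet_derivative u (at y) v) (at x) w) < e"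
    using \<open>d > 0\<close> unfolding eventually_at_right_field Dwv_def Dv_def by blast
qed

lemma second_derivative_symmetric:
  fixes u :: "'a::real_normed_vector \<Rightarrow> real"
  assumes "open S" "x \<in> S" "Ck_on (Suc (Suc 0)) S u"
  shows "frechet_derivative (\<lambda>y. frechet_derivative u (at y) v) (at x) w
    = frechet_derivative (\<lambda>y. frechet_derivative u (at y) w) (at x) v"
proof (rule tendsto_unique[OF trivial_limit_at_right_real second_difference_tendsto[OF assms]])
  show "((\<lambda>t. (u (x + t *\<^sub>R v + t *\<^sub>R w) - u (x + t *\<^sub>R v) - u (x + t *\<^sub>R w) + u x) / t\<^sup>2)
    \<longlongrightarrow> frechet_derivative (\<lambda>y. frechet_derivative u (at y) w) (at x) v) (at_right 0)"
    using second_difference_tendsto[OF assms, of w v] by (simp add: algebra_simps)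
qed

lemma partial_commute:
  assumes "open S" "x \<in> S" "Ck_on (Suc (Suc 0)) S F"
  shows "partial i (partial j F) x = partial j (partial i F) x"
  using second_derivative_symmetric[OF assms] by (simp add: partial_def[abs_def])

section \<open>The Einstein-Lovelock tensor in a chart\<close>

lemma Ck_on_matrix_nth:
  assumes "open S" "smooth_on S G"
  shows "Ck_on k S (\<lambda>y. G y $ i $ j)"
  using assms by (simp add: smooth_on_def Ck_on_vec_nth)

lemma Ck_on_christoffel:
  assumes "open S" and G: "smooth_on S G" and "\<And>x. x \<in> S \<Longrightarrow> det (G x) \<noteq> 0"
  shows "Ck_on k S (christoffel G l i j)"
  unfolding christoffel_def[abs_def]
  by (intro Ck_on_mult Ck_on_sum Ck_on_add Ck_on_diff Ck_on_const Ck_on_matrix_inv Ck_on_partial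
      Ck_on_matrix_nth assms)

lemma Ck_on_curvature:
  assumes "open S" and G: "smooth_on S G" and "\<And>x. x \<in> S \<Longrightarrow> det (G x) \<noteq> 0"
  shows "Ck_on k S (curvature G m i j l)"
  unfolding curvature_def[abs_def]
  by (intro Ck_on_mult Ck_on_sum Ck_on_add Ck_on_diff Ck_on_partial Ck_on_christoffel assms)

lemma continuous_on_riemann:
  assumes "open S" and G: "smooth_on S G" and "\<And>x. x \<in> S \<Longrightarrow> det (G x) \<noteq> 0"
  shows "continuous_on S (\<lambda>x. riemann G x $ I $ J)"
proof (cases "card I = 2 \<and> card J = 2")
  case True
  then show ?thesis
    using assms by (auto simp: riemann_def
        intro!: continuous_on_sum continuous_on_mult Ck_on_imp_continuous_on[OF Ck_on_curvature]
          Ck_on_imp_continuous_on[OF Ck_on_matrix_nth])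
next
  case False
  then have "riemann G x $ I $ J = 0" for x
    by (auto simp: riemann_def)
  then show ?thesis by simp
qed

lemma continuous_on_dform_mult:
  fixes \<omega> \<eta> :: "'a::topological_space \<Rightarrow> 'n::{finite,linorder} dform"
  assumes "\<And>I J. continuous_on S (\<lambda>x. \<omega> x $ I $ J)" and "\<And>I J. continuous_on S (\<lambda>x. \<eta> x $ I $ J)"
  shows "continuous_on S (\<lambda>x. dform_mult (\<omega> x) (\<eta> x) $ A $ B)"
  by (auto simp: dform_mult_def intro!: continuous_on_sum continuous_on_mult continuous_on_const assms)

lemma continuous_on_dform_power:
  fixes \<omega> :: "'a::topological_space \<Rightarrow> 'n::{finite,linorder} dform"
  assumes "\<And>I J. continuous_on S (\<lambda>x. \<omega> x $ I $ J)"
  shows "continuous_on S (\<lambda>x. dform_power (\<omega> x) m $ A $ B)"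
  unfolding dform_power_def
  by (induction m arbitrary: A B) (simp_all add: continuous_on_dform_mult assms)

text \<open>Testing the identity that characterizes \<open>hodge\<close> on the basis element of - K
  isolates one coefficient. The closed formula replaces the definite description and makes
  continuity in G visible.\<close>

lemma hodge_nth:
  "hodge G \<beta> $ K = shuffle_sign (- K) K * ((\<Sum>J\<in>UNIV. gram G (- K) J * \<beta> $ J) * vol G $ UNIV)"
proof -
  have "wedge \<alpha> (hodge G \<beta>) $ UNIV = ext_inner G \<alpha> \<beta> * vol G $ UNIV" for \<alpha>
    using theI'[OF hodge_unique_existence[of G \<beta>]] unfolding hodge_def by blast
  from this[of "axis (- K) 1"]
  have "shuffle_sign (- K) K * hodge G \<beta> $ K = (\<Sum>J\<in>UNIV. gram G (- K) J * \<beta> $ J) * vol G $ UNIV"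
    unfolding wedge_UNIV ext_inner_def
    by (simp add: axis_def if_distrib[of "(*) _"] if_distrib[of "\<lambda>x. x * _"]
        sum.swap[of _ UNIV UNIV] cong: if_cong)
  moreover have "shuffle_sign (- K) K * shuffle_sign (- K) K = 1"
    by (simp add: shuffle_sign_def flip: power_add mult_2)
  ultimately show ?thesis by (metis mult.assoc mult_1)
qed

lemma continuous_on_hodge:
  fixes G :: "'a::topological_space \<Rightarrow> 'n::{finite,linorder} rmat"
  assumes G: "continuous_on S G" and pos: "\<And>x. x \<in> S \<Longrightarrow> 0 < det (G x)"
  shows "continuous_on S (\<lambda>x. hodge (G x) \<beta> $ K)"
proof -
  have nth: "continuous_on S (\<lambda>x. G x $ i $ j)" for i j
    by (intro continuous_on_component G)
  have "continuous_on S (\<lambda>x. gram (G x) I J)" for I J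
    unfolding gram_def
    by (cases "card I = card J")
      (auto intro!: continuous_on_sum continuous_on_mult continuous_on_const continuous_on_prod nth)
  moreover have "continuous_on S (\<lambda>x. det (G x))"
    unfolding det_def
    by (intro continuous_on_sum continuous_on_mult continuous_on_const continuous_on_prod nth)
  then have "continuous_on S (\<lambda>x. vol (G x) $ UNIV)"
    using pos by (auto simp: vol_def less_imp_neq[THEN not_sym] intro!: continuous_intros)
  ultimately show ?thesis
    unfolding hodge_nth by (intro continuous_on_sum continuous_on_mult continuous_on_const)
qed

text \<open>The coefficients are polynomials in the entries of the metric, the curvature
  coefficients and 1 / sqrt (det G).\<close>

lemma continuous_on_einstein_lovelock:
  fixes G :: "'n::{finite,linorder} rvec \<Rightarrow> 'n rmat"
  assumes "open S" and G: "smooth_on S G" and pos: "\<And>x. x \<in> S \<Longrightarrow> 0 < det (G x)"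
  shows "continuous_on S (\<lambda>x. einstein_lovelock G k x $ I $ J)"
proof -
  have "continuous_on S (\<lambda>x. dform_of_matrix (G x) $ I $ J)" for I J
    using Ck_on_imp_continuous_on[OF Ck_on_matrix_nth[OF assms(1,2)]]
    by (cases "card I = 1 \<and> card J = 1") (auto simp: dform_of_matrix_def)
  moreover have "continuous_on S (\<lambda>x. riemann G x $ I $ J)" for I J
    using continuous_on_riemann[OF assms(1,2)] pos by force
  ultimately have "continuous_on S (\<lambda>x. ((1 / fact m) *\<^sub>R
      dform_mult (dform_power (dform_of_matrix (G x)) m) (dform_power (riemann G x) k)) $ I $ J)" for I J m
    by (simp, intro continuous_on_mult continuous_on_divide continuous_on_const
        continuous_on_dform_mult continuous_on_dform_power)
      simp_all
  moreover have "continuous_on S G"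
    using G unfolding smooth_on_def by (meson Ck_on_imp_continuous_on)
  ultimately show ?thesis
    using pos by (auto simp: einstein_lovelock_def dform_hodge_def dform_eval_def
        intro!: continuous_on_mult continuous_on_const continuous_on_sum continuous_on_hodge
        simp del: vector_scaleR_component)
qed

section \<open>Double forms of type (1,1) as matrices\<close>

definition dform_matrix :: "'n::{finite,linorder} dform \<Rightarrow> 'n rmat" where
  "dform_matrix S = (\<chi> i j. S $ {i} $ {j})"

text \<open>\<open>ext_of_vec\<close> vanishes off the singletons, so only coefficients on pairs of
  singletons contribute.\<close>

lemma dform_eval_ext_of_vec:
  "dform_eval S (ext_of_vec u) (ext_of_vec v) = u \<bullet> (dform_matrix S *v v)"
proof -
  have *: "(\<Sum>I\<in>UNIV. F I * ext_of_vec w $ I) = (\<Sum>i\<in>UNIV. F {i} * w $ i)" for F and w :: "'a rvec"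
  proof -
    have "(\<Sum>I\<in>UNIV. F I * ext_of_vec w $ I) = (\<Sum>I\<in>range (\<lambda>i. {i}). F I * ext_of_vec w $ I)"
      by (rule sum.mono_neutral_right) (auto simp: ext_of_vec_def card_1_singleton_iff)
    also have "\<dots> = (\<Sum>i\<in>UNIV. F {i} * w $ i)"
      by (subst sum.reindex) (auto simp: ext_of_vec_def)
    finally show ?thesis .
  qed
  have "dform_eval S (ext_of_vec u) (ext_of_vec v)
      = (\<Sum>I\<in>UNIV. (\<Sum>J\<in>UNIV. S $ I $ J * ext_of_vec v $ J) * ext_of_vec u $ I)"
    by (simp add: dform_eval_def sum_distrib_left sum_distrib_right mult_ac)
  also have "\<dots> = (\<Sum>i\<in>UNIV. (\<Sum>j\<in>UNIV. S $ {i} $ {j} * v $ j) * u $ i)"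
    unfolding * ..
  finally show ?thesis
    by (simp add: inner_matrix_vector_eq_sum dform_matrix_def sum_distrib_left sum_distrib_right mult_ac)
qed

lemma dform_matrix_of_matrix: "dform_matrix (dform_of_matrix B) = B"
  by (simp add: dform_matrix_def dform_of_matrix_def vec_eq_iff)

text \<open>Each summation over the frame contracts one pair of slots with G^-1. The result is free
  of the frame chosen by \<open>SOME\<close> and gives, up to sign, the second order coefficients of
  \<open>lovelock_operator\<close>.\<close>

lemma dform_inner11_eq_sum:
  fixes G B :: "'n::{finite,linorder} rmat"
  assumes "\<exists>e. orthonormal_frame G e"
  shows "dform_inner11 G S (dform_of_matrix B)
    = (\<Sum>c\<in>UNIV. \<Sum>d\<in>UNIV. (matrix_inv G ** dform_matrix S ** matrix_inv G) $ c $ d * B $ c $ d)"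
proof -
  define e where "e = (SOME e. orthonormal_frame G e)"
  have "orthonormal_frame G e"
    unfolding e_def using assms by (rule someI_ex)
  then have inv: "matrix_inv G $ a $ b = (\<Sum>i\<in>UNIV. e i $ a * e i $ b)" for a b
    by (rule matrix_inv_eq_sum_frame)
  let ?N = "matrix_inv G" and ?S = "dform_matrix S"
  have sym: "?N $ a $ b = ?N $ b $ a" for a b
    by (simp add: inv mult.commute)
  \<comment> \<open>Contraction over the index i; \<open>trace_frame\<close> below does the same for
    j.\<close>
  have sum_frame_inner: "(\<Sum>i\<in>UNIV. (e i \<bullet> u) * (e i \<bullet> v)) = u \<bullet> (?N *v v)" for u v
  proof -
    have "(\<Sum>i\<in>UNIV. (e i \<bullet> u) * (e i \<bullet> v))
        = (\<Sum>i\<in>UNIV. \<Sum>a\<in>UNIV. \<Sum>b\<in>UNIV. e i $ a * e i $ b * u $ a * v $ b)"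
      by (simp add: inner_vec_def sum_product mult_ac)
    also have "\<dots> = (\<Sum>a\<in>UNIV. \<Sum>i\<in>UNIV. \<Sum>b\<in>UNIV. e i $ a * e i $ b * u $ a * v $ b)"
      by (rule sum.swap)
    also have "\<dots> = (\<Sum>a\<in>UNIV. \<Sum>b\<in>UNIV. \<Sum>i\<in>UNIV. e i $ a * e i $ b * u $ a * v $ b)"
      by (intro sum.cong refl sum.swap)
    finally show ?thesis
      by (simp add: inner_matrix_vector_eq_sum inv sum_distrib_right)
  qed
  have trace_frame: "(\<Sum>j\<in>UNIV. e j \<bullet> (M *v e j)) = (\<Sum>a\<in>UNIV. \<Sum>b\<in>UNIV. M $ a $ b * ?N $ a $ b)"
    for M
  proof -
    have "(\<Sum>j\<in>UNIV. e j \<bullet> (M *v e j))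
        = (\<Sum>a\<in>UNIV. \<Sum>j\<in>UNIV. \<Sum>b\<in>UNIV. M $ a $ b * e j $ a * e j $ b)"
      unfolding inner_matrix_vector_eq_sum by (rule sum.swap)
    also have "\<dots> = (\<Sum>a\<in>UNIV. \<Sum>b\<in>UNIV. \<Sum>j\<in>UNIV. M $ a $ b * e j $ a * e j $ b)"
      by (intro sum.cong refl sum.swap)
    finally show ?thesis
      by (simp add: inv sum_distrib_left mult_ac)
  qed
  have "dform_inner11 G S (dform_of_matrix B)
      = (\<Sum>i\<in>UNIV. \<Sum>j\<in>UNIV. (e i \<bullet> (?S *v e j)) * (e i \<bullet> (B *v e j)))"
    unfolding dform_inner11_def e_def[symmetric]
    by (simp add: dform_eval_ext_of_vec dform_matrix_of_matrix)
  also have "\<dots> = (\<Sum>j\<in>UNIV. (?S *v e j) \<bullet> (?N *v (B *v e j)))"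
    unfolding sum_frame_inner[symmetric] by (rule sum.swap)
  also have "\<dots> = (\<Sum>j\<in>UNIV. e j \<bullet> ((transpose ?S ** ?N ** B) *v e j))"
    by (intro sum.cong refl)
      (metis dot_lmul_matrix inner_commute matrix_vector_mul_assoc transpose_matrix_vector)
  also have "\<dots> = (\<Sum>a\<in>UNIV. \<Sum>b\<in>UNIV. \<Sum>c\<in>UNIV. (?N ** ?S) $ c $ a * B $ c $ b * ?N $ a $ b)"
  proof -
    have "(transpose ?S ** ?N) $ a $ c = (?N ** ?S) $ c $ a" for a c
      by (simp add: matrix_matrix_mult_def transpose_def sym[of _ c] mult.commute)
    then show ?thesis
      unfolding trace_frame
      by (simp add: matrix_matrix_mult_def[of "_ ** _" B] sum_distrib_right)
  qed
  also have "\<dots> = (\<Sum>b\<in>UNIV. \<Sum>a\<in>UNIV. \<Sum>c\<in>UNIV. (?N ** ?S) $ c $ a * B $ c $ b * ?N $ a $ b)"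
    by (rule sum.swap)
  also have "\<dots> = (\<Sum>b\<in>UNIV. \<Sum>c\<in>UNIV. \<Sum>a\<in>UNIV. (?N ** ?S) $ c $ a * B $ c $ b * ?N $ a $ b)"
    by (intro sum.cong refl sum.swap)
  also have "\<dots> = (\<Sum>c\<in>UNIV. \<Sum>b\<in>UNIV. \<Sum>a\<in>UNIV. (?N ** ?S) $ c $ a * B $ c $ b * ?N $ a $ b)"
    by (rule sum.swap)
  finally show ?thesis
    by (simp add: matrix_matrix_mult_def[of "_ ** _" ?N] sum_distrib_left sum_distrib_right mult_ac)
qed

section \<open>The strong maximum principle\<close>

text \<open>If the second derivative along h were positive, the slope along h, zero at q, would be
  positive just after q, and v would rise above its maximum.\<close>

lemma local_max_derivative_tests:
  fixes v :: "real^'n \<Rightarrow> real"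
  assumes "open S" "q \<in> S"
    and grad: "\<And>x. x \<in> S \<Longrightarrow> (v has_derivative (\<lambda>h. p x \<bullet> h)) (at x)"
    and hess: "(p has_derivative (\<lambda>h. H *v h)) (at q)"
    and max: "\<And>x. x \<in> S \<Longrightarrow> v x \<le> v q"
  shows "p q = 0" and "h \<bullet> (H *v h) \<le> 0"
proof -
  obtain d where d: "d > 0" "ball q d \<subseteq> S"
    using assms(1,2) open_contains_ball by blast
  have line: "q + r *\<^sub>R h \<in> S" if "\<bar>r\<bar> * norm h < d" for r h
    using d(2) that by (auto simp: subset_iff dist_norm)
  have der: "((\<lambda>r. v (q + r *\<^sub>R h)) has_real_derivative p (q + r *\<^sub>R h) \<bullet> h) (at r)"
    if "\<bar>r\<bar> * norm h < d" for r h
    by (rule has_derivative_imp_DERIV_line[OF grad[OF line[OF that]]])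
  have "((\<lambda>h. p q \<bullet> h) = (\<lambda>h. 0))"
    using differential_zero_maxmin[OF assms(2,1) grad[OF assms(2)]] max by blast
  then show pq: "p q = 0"
    by (metis inner_eq_zero_iff)
  show "h \<bullet> (H *v h) \<le> 0"
  proof (rule ccontr)
    assume "\<not> h \<bullet> (H *v h) \<le> 0"
    then have pos: "0 < h \<bullet> (H *v h)" and "norm h > 0" by auto
    have "((\<lambda>r. p (q + r *\<^sub>R h) \<bullet> h) has_real_derivative (H *v h) \<bullet> h) (at 0)"
      by (rule has_derivative_imp_DERIV_line[where a = q and u = "\<lambda>x. p x \<bullet> h"])
        (auto intro!: derivative_eq_intros hess)
    from DERIV_pos_inc_right[OF this] obtain e where e: "e > 0"
      "\<And>r. 0 < r \<Longrightarrow> r < e \<Longrightarrow> 0 < p (q + r *\<^sub>R h) \<bullet> h"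
      using pos pq by (auto simp: inner_commute)
    \<comment> \<open>Below e, where the slope is positive, and small enough for the segment to stay
      in the ball of radius d.\<close>
    define t where "t = min (e / 2) (d / (2 * norm h))"
    have t: "0 < t" "t < e" "t * norm h < d"
      using e(1) d(1) \<open>norm h > 0\<close> by (auto simp: t_def min_def field_simps)
    have small: "\<bar>r\<bar> * norm h < d" if "0 \<le> r" "r \<le> t" for r
      using that t(3) mult_right_mono[of r t "norm h"] by simp
    obtain r where r: "0 < r" "r < t" "v (q + t *\<^sub>R h) - v (q + 0 *\<^sub>R h) = (t - 0) * (p (q + r *\<^sub>R h) \<bullet> h)"
      using MVT2[OF t(1) der[OF small]] by blast
    have "0 < v (q + t *\<^sub>R h) - v q"
      using r e(2)[of r] t by simp
    moreover have "v (q + t *\<^sub>R h) \<le> v q"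
      using t by (intro max line) simp
    ultimately show False by simp
  qed
qed

lemma elliptic_at_local_max_nonpos:
  fixes v :: "real^'n \<Rightarrow> real"
  assumes "open S" "q \<in> S"
    and "\<And>x. x \<in> S \<Longrightarrow> (v has_derivative (\<lambda>h. p x \<bullet> h)) (at x)"
    and "(p has_derivative (\<lambda>h. H *v h)) (at q)" and "transpose H = H"
    and "\<And>x. x \<in> S \<Longrightarrow> v x \<le> v q"
    and "\<And>h. 0 \<le> h \<bullet> (a *v h)"
  shows "(\<Sum>i\<in>UNIV. \<Sum>j\<in>UNIV. a $ i $ j * H $ i $ j) + b \<bullet> p q \<le> 0"
  using sum_mult_psd_nsd_nonpos[OF assms(7,5)] local_max_derivative_tests[OF assms(1-4,6)] by simp

text \<open>The Hessian of exp (- c |x - y|^2), with \<xi> standing for x - y.\<close>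

definition barrier_hessian :: "real \<Rightarrow> real^'n \<Rightarrow> real^'n^'n" where
  "barrier_hessian c \<xi> = (\<chi> i j.
    exp (- c * (\<xi> \<bullet> \<xi>)) * (4 * c\<^sup>2 * \<xi> $ i * \<xi> $ j - (if i = j then 2 * c else 0)))"

lemma barrier_has_derivative:
  fixes c :: real and y x :: "real^'n"
  defines "w \<equiv> \<lambda>x. exp (- c * ((x - y) \<bullet> (x - y)))"
  shows "(w has_derivative (\<lambda>h. ((- 2 * c * w x) *\<^sub>R (x - y)) \<bullet> h)) (at x)"
    and "((\<lambda>x. (- 2 * c * w x) *\<^sub>R (x - y)) has_derivative (\<lambda>h. barrier_hessian c (x - y) *v h)) (at x)"
proof -
  show w: "(w has_derivative (\<lambda>h. ((- 2 * c * w x) *\<^sub>R (x - y)) \<bullet> h)) (at x)" for x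
    unfolding w_def
    by (auto intro!: derivative_eq_intros simp: inner_commute algebra_simps)
  have nth: "(barrier_hessian c \<xi> *v h) $ i
      = exp (- c * (\<xi> \<bullet> \<xi>)) * (4 * c\<^sup>2 * (\<xi> \<bullet> h) * \<xi> $ i - 2 * c * h $ i)"
    for i h and \<xi> :: "real^'n"
  proof -
    have "(barrier_hessian c \<xi> *v h) $ i
        = (\<Sum>j\<in>UNIV. exp (- c * (\<xi> \<bullet> \<xi>)) * (4 * c\<^sup>2 * \<xi> $ i * (\<xi> $ j * h $ j)
            - (if i = j then 2 * c * h $ j else 0)))"
      unfolding barrier_hessian_def matrix_vector_mult_def vec_lambda_beta
      by (intro sum.cong refl) (simp add: algebra_simps)
    also have "\<dots> = exp (- c * (\<xi> \<bullet> \<xi>)) * (4 * c\<^sup>2 * \<xi> $ i * (\<xi> \<bullet> h) - 2 * c * h $ i)"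
      by (simp add: sum_subtractf inner_vec_def flip: sum_distrib_left)
    finally show ?thesis by (simp add: mult_ac)
  qed
  have "barrier_hessian c \<xi> *v h = (- 2 * c * exp (- c * (\<xi> \<bullet> \<xi>))) *\<^sub>R h
      + (- 2 * c * (((- 2 * c * exp (- c * (\<xi> \<bullet> \<xi>))) *\<^sub>R \<xi>) \<bullet> h)) *\<^sub>R \<xi>"
    for h and \<xi> :: "real^'n"
    by (simp add: vec_eq_iff nth power2_eq_square algebra_simps)
  from this[of "x - y"] have "barrier_hessian c (x - y) *v h
      = (- 2 * c * w x) *\<^sub>R h + (- 2 * c * (((- 2 * c * w x) *\<^sub>R (x - y)) \<bullet> h)) *\<^sub>R (x - y)" for h
    unfolding w_def .
  then show "((\<lambda>x. (- 2 * c * w x) *\<^sub>R (x - y)) has_derivative (\<lambda>h. barrier_hessian c (x - y) *v h)) (at x)"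
    by (auto intro!: derivative_eq_intros w)
qed

text \<open>Apart from the exponential, the quadratic form carries c^2, while trace and drift carry
  only c. For large c the quadratic form decides the sign.\<close>

lemma barrier_operator_value:
  fixes a :: "real^'n^'n"
  shows "(\<Sum>i\<in>UNIV. \<Sum>j\<in>UNIV. a $ i $ j * barrier_hessian c \<xi> $ i $ j)
      + b \<bullet> ((- 2 * c * exp (- c * (\<xi> \<bullet> \<xi>))) *\<^sub>R \<xi>)
    = 2 * c * exp (- c * (\<xi> \<bullet> \<xi>)) * (2 * c * (\<xi> \<bullet> (a *v \<xi>)) - (trace a + b \<bullet> \<xi>))"
proof -
  have "(\<Sum>i\<in>UNIV. \<Sum>j\<in>UNIV. a $ i $ j * barrier_hessian c \<xi> $ i $ j)
      = (\<Sum>i\<in>UNIV. \<Sum>j\<in>UNIV. exp (- c * (\<xi> \<bullet> \<xi>)) * (4 * c\<^sup>2 * (a $ i $ j * \<xi> $ i * \<xi> $ j)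
          - (if i = j then 2 * c * a $ i $ j else 0)))"
    by (intro sum.cong refl) (simp add: barrier_hessian_def algebra_simps)
  also have "\<dots> = exp (- c * (\<xi> \<bullet> \<xi>)) * (4 * c\<^sup>2 * (\<xi> \<bullet> (a *v \<xi>)) - 2 * c * trace a)"
    by (simp add: inner_matrix_vector_eq_sum trace_def sum_subtractf flip: sum_distrib_left)
  finally show ?thesis by (simp add: power2_eq_square algebra_simps)
qed

text \<open>
  For a large constant \<open>c\<close> the barrier \<open>exp (- c \<bar>x - y\<bar>\<^sup>2)\<close> is a strict subsolution near the point \<open>z\<close>
  where the ball touches the maximum set. Adding a small multiple of it to \<open>u\<close> keeps the values on a
  small sphere around \<open>z\<close> below the value at \<open>z\<close>, which forces an interior maximum.
\<close>

lemma hopf_touching_ball: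
  fixes u :: "real^'n \<Rightarrow> real" and a :: "real^'n \<Rightarrow> real^'n^'n" and b p :: "real^'n \<Rightarrow> real^'n"
  assumes "open S"
    and u: "\<And>x. x \<in> S \<Longrightarrow> (u has_derivative (\<lambda>h. p x \<bullet> h)) (at x)"
    and p: "\<And>x. x \<in> S \<Longrightarrow> (p has_derivative (\<lambda>h. H x *v h)) (at x)"
    and H: "\<And>x. x \<in> S \<Longrightarrow> transpose (H x) = H x"
    and a: "continuous_on S a" and b: "continuous_on S b"
    and ell: "\<And>x v. x \<in> S \<Longrightarrow> v \<noteq> 0 \<Longrightarrow> 0 < v \<bullet> (a x *v v)"
    and pde: "\<And>x. x \<in> S \<Longrightarrow> 0 \<le> (\<Sum>i\<in>UNIV. \<Sum>j\<in>UNIV. a x $ i $ j * H x $ i $ j) + b x \<bullet> p x"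
    and z: "z \<in> S" "dist y z = \<rho>" and \<rho>: "\<rho> > 0"
    and max: "\<And>x. x \<in> S \<Longrightarrow> u x \<le> u z"
    and touch: "\<And>x. x \<in> S \<Longrightarrow> dist y x \<le> \<rho> \<Longrightarrow> u x = u z \<Longrightarrow> x = z"
  shows False
proof -
  obtain d where d: "d > 0" "cball z d \<subseteq> S"
    using assms(1) z(1) open_contains_cball by blast
  \<comment> \<open>A radius below \<rho> keeps y outside the small ball, so x - y never vanishes
    there and its quadratic form has a positive minimum l.\<close>
  define \<delta> where "\<delta> = min d (\<rho> / 2)"
  have \<delta>: "0 < \<delta>" "\<delta> < \<rho>" "cball z \<delta> \<subseteq> S"
    using d \<rho> by (auto simp: \<delta>_def)
  let ?K = "cball z \<delta>"
  have zK: "z \<in> ?K" using \<delta> by simp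
  then have K: "compact ?K" "?K \<noteq> {}" by auto
  have ne: "x - y \<noteq> 0" if "x \<in> ?K" for x
    using that z(2) \<delta>(2) by (auto simp: dist_commute)
  have u_cont: "continuous_on S u"
    using u by (meson continuous_at_imp_continuous_on has_derivative_continuous)
  have aK: "continuous_on ?K a" and bK: "continuous_on ?K b" and uK: "continuous_on ?K u"
    using a b u_cont \<delta>(3) continuous_on_subset by blast+
  have "continuous_on ?K (\<lambda>x. (x - y) \<bullet> (a x *v (x - y)))"
    unfolding inner_matrix_vector_eq_sum by (intro continuous_intros aK)
  then obtain x1 where x1: "x1 \<in> ?K"
    "\<And>x. x \<in> ?K \<Longrightarrow> (x1 - y) \<bullet> (a x1 *v (x1 - y)) \<le> (x - y) \<bullet> (a x *v (x - y))"
    using continuous_attains_inf[OF K] by blast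
  define l where "l = (x1 - y) \<bullet> (a x1 *v (x1 - y))"
  have l: "0 < l"
    unfolding l_def using x1(1) ell ne \<delta>(3) by blast
  have "continuous_on ?K (\<lambda>x. trace (a x) + b x \<bullet> (x - y))"
    unfolding trace_def by (intro continuous_intros aK bK)
  then obtain B where B: "\<And>x. x \<in> ?K \<Longrightarrow> trace (a x) + b x \<bullet> (x - y) \<le> B"
    using continuous_attains_sup[OF K] by blast
  \<comment> \<open>Makes \<open>2 * c * l\<close> equal to |B| + 1, which exceeds the bound B on
    trace and drift.\<close>
  define c where "c = (\<bar>B\<bar> + 1) / (2 * l)"
  have c: "c > 0" "2 * c * l = \<bar>B\<bar> + 1"
    using l by (simp_all add: c_def)
  define w where "w x = exp (- c * ((x - y) \<bullet> (x - y)))" for x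
  have Lw: "0 < (\<Sum>i\<in>UNIV. \<Sum>j\<in>UNIV. a x $ i $ j * barrier_hessian c (x - y) $ i $ j)
      + b x \<bullet> ((- 2 * c * w x) *\<^sub>R (x - y))" if "x \<in> ?K" for x
  proof -
    have "trace (a x) + b x \<bullet> (x - y) < 2 * c * l"
      using B[OF that] c by linarith
    also have "\<dots> \<le> 2 * c * ((x - y) \<bullet> (a x *v (x - y)))"
      using x1(2)[OF that] c(1) unfolding l_def by (intro mult_left_mono) auto
    finally show ?thesis
      unfolding w_def barrier_operator_value using c by simp
  qed
  \<comment> \<open>On the part of the small sphere inside the touching ball, \<open>touch\<close>
    excludes the value u z, and compactness makes the gap uniform. If that part is empty, any
    positive number serves.\<close>
  obtain \<eta> where \<eta>: "\<eta> > 0" "\<And>x. dist z x = \<delta> \<Longrightarrow> dist y x \<le> \<rho> \<Longrightarrow> u x \<le> u z - \<eta>"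
  proof (cases "sphere z \<delta> \<inter> cball y \<rho> = {}")
    case True
    then show ?thesis by (intro that[of 1]) auto
  next
    case False
    have "compact (sphere z \<delta> \<inter> cball y \<rho>)" by (simp add: compact_Int_closed)
    moreover have "continuous_on (sphere z \<delta> \<inter> cball y \<rho>) u"
      using uK by (rule continuous_on_subset) auto
    ultimately obtain x2 where x2: "x2 \<in> sphere z \<delta> \<inter> cball y \<rho>"
      "\<And>x. x \<in> sphere z \<delta> \<inter> cball y \<rho> \<Longrightarrow> u x \<le> u x2"
      using continuous_attains_sup[of "sphere z \<delta> \<inter> cball y \<rho>" u] False by blast
    have x2S: "x2 \<in> S" using x2(1) \<delta>(3) by auto
    have "x2 \<noteq> z" "dist y x2 \<le> \<rho>" using x2(1) \<delta>(1) by auto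
    then have "u x2 < u z"
      using touch[OF x2S] max[OF x2S] by linarith
    then show ?thesis
      using x2(2) by (intro that[of "u z - u x2"]) auto
  qed
  \<comment> \<open>As w is at most 1, the added term stays below the gap \<eta>.\<close>
  define \<epsilon> where "\<epsilon> = \<eta> / 2"
  have \<epsilon>: "\<epsilon> > 0" "\<epsilon> < \<eta>" using \<eta>(1) by (simp_all add: \<epsilon>_def)
  define v where "v x = u x + \<epsilon> * w x" for x
  have w_le: "w x \<le> 1" "0 < w x" for x
    using c by (simp_all add: w_def)
  have bdry: "v x < v z" if "dist z x = \<delta>" for x
  proof (cases "dist y x \<le> \<rho>")
    case True
    have "v x \<le> u z - \<eta> + \<epsilon> * 1"
      unfolding v_def using \<eta>(2)[OF that True] w_le(1)[of x] \<epsilon>(1)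
      by (intro add_mono mult_left_mono) auto
    also have "\<dots> < u z" using \<epsilon> by simp
    also have "\<dots> < v z" using \<epsilon>(1) w_le(2)[of z] by (simp add: v_def)
    finally show ?thesis .
  next
    case False
    have "x \<in> S" using that \<delta>(3) by auto
    \<comment> \<open>Outside the touching ball there is no gap, but x is farther from y than z is,
      so the barrier is smaller at x.\<close>
    have "(z - y) \<bullet> (z - y) < (x - y) \<bullet> (x - y)"
      using power_strict_mono[of "norm (z - y)" "norm (x - y)" 2] False z(2)
      by (simp add: dist_norm norm_minus_commute[of y] power2_norm_eq_inner)
    then have "w x < w z"
      using c by (simp add: w_def)
    then show ?thesis
      using max[OF \<open>x \<in> S\<close>] \<epsilon>(1) by (simp add: v_def add_le_less_mono)
  qed
  have "continuous_on ?K v"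
    unfolding v_def w_def by (intro continuous_intros uK)
  then obtain q where q: "q \<in> ?K" "\<And>x. x \<in> ?K \<Longrightarrow> v x \<le> v q"
    using continuous_attains_sup[OF K] by blast
  have "dist z q \<noteq> \<delta>"
    using bdry[of q] q(2)[OF zK] by auto
  then have qball: "q \<in> ball z \<delta>" using q(1) by simp
  have qS: "q \<in> S" using q(1) \<delta>(3) by blast
  define P where "P x = p x + \<epsilon> *\<^sub>R ((- 2 * c * w x) *\<^sub>R (x - y))" for x
  define Q where "Q = H q + \<epsilon> *\<^sub>R barrier_hessian c (q - y)"
  have "(\<Sum>i\<in>UNIV. \<Sum>j\<in>UNIV. a q $ i $ j * Q $ i $ j) + b q \<bullet> P q \<le> 0"
  proof (rule elliptic_at_local_max_nonpos[OF open_ball qball])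
    show "(v has_derivative (\<lambda>h. P x \<bullet> h)) (at x)" if "x \<in> ball z \<delta>" for x
    proof -
      have "x \<in> S" using that \<delta>(3) by auto
      from has_derivative_add[OF u[OF this]
          has_derivative_mult_right[OF barrier_has_derivative(1)[where c = c and y = y], of \<epsilon>]]
      show ?thesis
        unfolding v_def[abs_def] w_def
        by (rule has_derivative_eq_rhs) (simp add: fun_eq_iff P_def w_def inner_diff_left)
    qed
    have "(P has_derivative (\<lambda>h. H q *v h + \<epsilon> *\<^sub>R (barrier_hessian c (q - y) *v h))) (at q)"
      unfolding P_def[abs_def] w_def
      by (intro has_derivative_add p[OF qS] has_derivative_scaleR_right barrier_has_derivative)
    then show "(P has_derivative (\<lambda>h. Q *v h)) (at q)"
      by (simp add: Q_def matrix_vector_mult_add_rdistrib scaleR_matrix_vector_assoc)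
    show "transpose Q = Q"
      using H[OF qS] by (simp add: Q_def barrier_hessian_def transpose_def vec_eq_iff mult_ac)
    show "v x \<le> v q" if "x \<in> ball z \<delta>" for x
      using q(2) that by simp
    show "0 \<le> h \<bullet> (a q *v h)" for h
      using ell[OF qS, of h] by (cases "h = 0") auto
  qed
  \<comment> \<open>By linearity the value for v, at most 0 at its maximum q, is a nonnegative value
    for u plus \<epsilon> times a positive value for w.\<close>
  also have "(\<Sum>i\<in>UNIV. \<Sum>j\<in>UNIV. a q $ i $ j * Q $ i $ j) + b q \<bullet> P q
      = ((\<Sum>i\<in>UNIV. \<Sum>j\<in>UNIV. a q $ i $ j * H q $ i $ j) + b q \<bullet> p q)
        + \<epsilon> * ((\<Sum>i\<in>UNIV. \<Sum>j\<in>UNIV. a q $ i $ j * barrier_hessian c (q - y) $ i $ j)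
          + b q \<bullet> ((- 2 * c * w q) *\<^sub>R (q - y)))"
    by (simp add: Q_def P_def distrib_left sum.distrib inner_add_right inner_diff_right
        right_diff_distrib sum_distrib_left mult_ac)
  finally show False
    using pde[OF qS] mult_pos_pos[OF \<epsilon>(1) Lw[OF q(1)]] by linarith
qed

text \<open>If u were below its maximum at some y0 near x0, a ball growing around y0 until it meets
  the maximum set would lead to the situation excluded by \<open>hopf_touching_ball\<close>. Taking
  y0 within R / 2 of x0 keeps the growing ball inside the closed ball of radius R.\<close>

theorem strong_maximum_principle:
  fixes u :: "real^'n \<Rightarrow> real" and a :: "real^'n \<Rightarrow> real^'n^'n" and b p :: "real^'n \<Rightarrow> real^'n"
  assumes "open S"
    and u: "\<And>x. x \<in> S \<Longrightarrow> (u has_derivative (\<lambda>h. p x \<bullet> h)) (at x)"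
    and p: "\<And>x. x \<in> S \<Longrightarrow> (p has_derivative (\<lambda>h. H x *v h)) (at x)"
    and H: "\<And>x. x \<in> S \<Longrightarrow> transpose (H x) = H x"
    and a: "continuous_on S a" and b: "continuous_on S b"
    and ell: "\<And>x v. x \<in> S \<Longrightarrow> v \<noteq> 0 \<Longrightarrow> 0 < v \<bullet> (a x *v v)"
    and pde: "\<And>x. x \<in> S \<Longrightarrow> 0 \<le> (\<Sum>i\<in>UNIV. \<Sum>j\<in>UNIV. a x $ i $ j * H x $ i $ j) + b x \<bullet> p x"
    and x0: "x0 \<in> S" and max: "\<And>x. x \<in> S \<Longrightarrow> u x \<le> u x0"
  shows "\<exists>r>0. ball x0 r \<subseteq> S \<and> (\<forall>x\<in>ball x0 r. u x = u x0)"
proof -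
  obtain R where R: "R > 0" "cball x0 R \<subseteq> S"
    using assms(1) x0 open_contains_cball by blast
  have "u y0 = u x0" if y0: "y0 \<in> ball x0 (R / 2)" for y0
  proof (rule ccontr)
    assume neq: "u y0 \<noteq> u x0"
    define C where "C = {x \<in> cball x0 R. u x = u x0}"
    have "isCont u x" if "x \<in> S" for x
      using has_derivative_continuous[OF u[OF that]] .
    then have "continuous_on (cball x0 R) u"
      using R(2) by (blast intro: continuous_at_imp_continuous_on)
    then have "closed C"
      unfolding C_def by (intro continuous_closed_preimage_constant) auto
    moreover have x0C: "x0 \<in> C" using R by (simp add: C_def)
    ultimately obtain z where z: "z \<in> C" "\<And>x. x \<in> C \<Longrightarrow> dist y0 z \<le> dist y0 x"
      using distance_attains_inf[of C y0] by blast
    have near: "dist y0 z < R / 2"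
      using z(2)[OF x0C] y0 by (simp add: dist_commute)
    have "y0 \<noteq> z" using neq z(1) by (auto simp: C_def)
    \<comment> \<open>The ball around \<open>y0\<close> may meet \<open>C\<close> in several points; half of it meets \<open>C\<close> only in \<open>z\<close>.\<close>
    define \<rho> where "\<rho> = dist y0 z / 2"
    define y where "y = midpoint y0 z"
    have \<rho>: "0 < \<rho>" "dist y z = \<rho>" "norm (y - y0) = \<rho>"
      using \<open>y0 \<noteq> z\<close> dist_midpoint[of y0 z] by (simp_all add: \<rho>_def y_def dist_norm norm_minus_commute)
    show False
    proof (rule hopf_touching_ball[OF assms(1) u p H a b ell pde _ \<rho>(2,1)])
      show "z \<in> S" using z(1) R(2) by (auto simp: C_def)
      have uz: "u z = u x0" using z(1) by (simp add: C_def)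
      then show "u x \<le> u z" if "x \<in> S" for x using max[OF that] by simp
      show "x = z" if x: "dist y x \<le> \<rho>" "u x = u z" for x
      proof -
        have xy: "norm (x - y) \<le> \<rho>" using x(1) by (simp add: dist_norm norm_minus_commute)
        \<comment> \<open>The half ball lies in the ball about y0 through z, hence in the closed
          ball of radius R, where the minimality of z applies.\<close>
        have "dist y0 x \<le> \<rho> + \<rho>"
          using dist_triangle[of y0 x y] x(1) \<rho>(3) by (simp add: dist_norm norm_minus_commute)
        then have "dist x0 x \<le> R"
          using dist_triangle[of x0 x y0] y0 near by (simp add: \<rho>_def)
        then have "x \<in> C" using x(2) uz by (simp add: C_def)
        then have "\<rho> + \<rho> \<le> norm ((x - y) + (y - y0))"
          using z(2)[of x] by (simp add: \<rho>_def dist_norm norm_minus_commute)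
        then have "(\<rho> + \<rho>)\<^sup>2 \<le> (norm ((x - y) + (y - y0)))\<^sup>2"
          using \<rho>(1) by (intro power_mono) auto
        moreover have "(\<rho> + \<rho>)\<^sup>2 = 4 * \<rho>\<^sup>2"
          by (simp add: power2_eq_square)
        moreover have "(norm (x - y))\<^sup>2 \<le> \<rho>\<^sup>2" "(norm (y - y0))\<^sup>2 = \<rho>\<^sup>2"
          using xy \<rho>(3) by (auto intro: power_mono)
        \<comment> \<open>Parallelogram law: two vectors of length at most \<rho> whose sum has
          length at least 2 \<rho> must coincide.\<close>
        moreover have "(norm ((x - y) + (y - y0)))\<^sup>2 + (norm ((x - y) - (y - y0)))\<^sup>2
            = 2 * (norm (x - y))\<^sup>2 + 2 * (norm (y - y0))\<^sup>2"
          by (simp only: power2_norm_eq_inner inner_add_left inner_add_right inner_diff_left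
              inner_diff_right) simp
        ultimately have "(norm ((x - y) - (y - y0)))\<^sup>2 \<le> 0"
          by linarith
        then have eq: "x - y = y - y0"
          by (simp only: power2_less_eq_zero_iff norm_eq_zero right_minus_eq)
        have "x = (x - y) + y" by simp
        also have "\<dots> = (y + y) - y0" unfolding eq by (simp only: diff_add_eq)
        also have "y + y = y0 + z"
          by (simp add: y_def midpoint_def flip: scaleR_add_left)
        also have "y0 + z - y0 = z" by simp
        finally show ?thesis .
      qed
    qed
  qed
  moreover have "ball x0 (R / 2) \<subseteq> cball x0 R"
    using R(1) by (intro ball_subset_cball[THEN order_trans] subset_cball) simp
  then have "ball x0 (R / 2) \<subseteq> S"
    using R(2) by (rule order_trans)
  moreover have "0 < R / 2" using R(1) by simp
  ultimately show ?thesis by blast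
qed

section \<open>Lovelock-harmonic functions\<close>

lemma has_derivative_gradient:
  fixes F :: "real^'n \<Rightarrow> real"
  assumes "F differentiable (at x)"
  shows "(F has_derivative (\<lambda>h. (\<chi> i. partial i F x) \<bullet> h)) (at x)"
proof -
  let ?D = "frechet_derivative F (at x)"
  have D: "(F has_derivative ?D) (at x)"
    using assms by (simp add: frechet_derivative_works)
  interpret D: bounded_linear ?D using D by (rule has_derivative_bounded_linear)
  have "?D h = (\<chi> i. partial i F x) \<bullet> h" for h
  proof -
    have "?D h = ?D (\<Sum>i\<in>UNIV. h $ i *\<^sub>R axis i 1)"
      by (simp add: basis_expansion flip: scalar_mult_eq_scaleR)
    also have "\<dots> = (\<Sum>i\<in>UNIV. h $ i * ?D (axis i 1))"
      by (simp add: D.sum D.scaleR)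
    finally show ?thesis
      by (simp add: inner_vec_def partial_def mult.commute)
  qed
  then have "?D = (\<lambda>h. (\<chi> i. partial i F x) \<bullet> h)" by blast
  with D show ?thesis by simp
qed

lemma has_derivative_vec_componentwise:
  fixes p :: "'a::real_normed_vector \<Rightarrow> real^'n"
  assumes "\<And>i. ((\<lambda>x. p x $ i) has_derivative (\<lambda>h. p' h $ i)) (at x)"
  shows "(p has_derivative p') (at x)"
  unfolding has_derivative_componentwise_within[of p]
proof
  fix b :: "real^'n"
  assume "b \<in> Basis"
  then obtain i where "b = axis i 1" by (auto simp: Basis_vec_def)
  then show "((\<lambda>x. p x \<bullet> b) has_derivative (\<lambda>x. p' x \<bullet> b)) (at x)"
    using assms[of i] by (simp add: inner_axis)
qed

text \<open>Row i is the gradient of \<open>partial i F\<close>, so the partial derivatives come in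
  the order opposite to \<open>hessian\<close>; \<open>partial_commute\<close> reconciles the
  two.\<close>

lemma has_derivative_hessian:
  fixes F :: "real^'n \<Rightarrow> real"
  assumes "x \<in> S" "Ck_on (Suc (Suc 0)) S F"
  shows "((\<lambda>y. \<chi> i. partial i F y) has_derivative (\<lambda>h. (\<chi> i j. partial j (partial i F) x) *v h)) (at x)"
proof (rule has_derivative_vec_componentwise)
  fix i
  have "partial i F differentiable (at x)"
    using Ck_on_partial[OF assms(2), of i] assms(1) by simp
  from has_derivative_gradient[OF this]
  show "((\<lambda>y. (\<chi> i. partial i F y) $ i) has_derivative
      (\<lambda>h. ((\<chi> i j. partial j (partial i F) x) *v h) $ i)) (at x)"
    by (simp add: matrix_vector_mult_def inner_vec_def)
qed

lemma lovelock_harmonic_max_locally_constant: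
  fixes G :: "'n::{finite,linorder} rvec \<Rightarrow> 'n rmat"
  assumes S: "open S" and G: "smooth_on S G"
    and sym: "\<And>x. x \<in> S \<Longrightarrow> transpose (G x) = G x"
    and pos: "\<And>x v. x \<in> S \<Longrightarrow> v \<noteq> 0 \<Longrightarrow> 0 < vec_inner (G x) v v"
    and def: "(\<forall>x\<in>S. pos_def11 (einstein_lovelock G k x)) \<or> (\<forall>x\<in>S. neg_def11 (einstein_lovelock G k x))"
    and F: "smooth_on S F"
    and harm: "\<And>x. x \<in> S \<Longrightarrow> lovelock_operator G k F x = 0"
    and max: "x0 \<in> S" "\<And>x. x \<in> S \<Longrightarrow> F x \<le> F x0"
  shows "\<exists>r>0. ball x0 r \<subseteq> S \<and> (\<forall>x\<in>ball x0 r. F x = F x0)"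
proof -
  define T where "T x = dform_matrix (einstein_lovelock G k x)" for x
  \<comment> \<open>s is 1 or -1 according to the sign of definiteness. The equation is homogeneous,
    so multiplying it by s keeps it valid and makes its coefficient matrix positive
    definite.\<close>
  obtain s :: real where s: "\<And>x v. x \<in> S \<Longrightarrow> v \<noteq> 0 \<Longrightarrow> 0 < s * (v \<bullet> (T x *v v))"
  proof (cases "\<forall>x\<in>S. pos_def11 (einstein_lovelock G k x)")
    case True
    then show ?thesis
      by (intro that[of 1]) (auto simp: pos_def11_def dform_eval_ext_of_vec T_def)
  next
    case False
    then show ?thesis
      using def by (intro that[of "- 1"]) (auto simp: neg_def11_def dform_eval_ext_of_vec T_def)
  qed
  define N where "N x = matrix_inv (G x)" for x
  have pos': "0 < v \<bullet> (G x *v v)" if "x \<in> S" "v \<noteq> 0" for x v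
    using pos[OF that] by (simp add: vec_inner_def)
  have det: "0 < det (G x)" if "x \<in> S" for x
    using posdef_det_pos[OF sym[OF that] pos'[OF that]] .
  have frame: "\<exists>e. orthonormal_frame (G x) e" if "x \<in> S" for x
    using orthonormal_frame_exists[OF sym[OF that] pos'[OF that]] .
  have N_sym: "transpose (N x) = N x" if "x \<in> S" for x
    using frame[OF that]
    by (auto simp: N_def vec_eq_iff transpose_def matrix_inv_eq_sum_frame mult.commute)
  \<comment> \<open>The form of G^-1 T G^-1 at v is that of T at G^-1 v, so injectivity of G^-1
    transfers definiteness.\<close>
  have N_inj: "N x *v v \<noteq> 0" if "x \<in> S" "v \<noteq> 0" for x v
  proof
    assume "N x *v v = 0"
    moreover have "G x ** N x = mat 1"
      unfolding N_def using det[OF that(1)] by (intro matrix_mul_matrix_inv) simp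
    then have "G x *v (N x *v v) = v"
      by (simp add: matrix_vector_mul_assoc)
    ultimately show False using that(2) by simp
  qed
  have FC: "Ck_on (Suc (Suc 0)) S F" using F by (simp add: smooth_on_def)
  define a where "a x = s *\<^sub>R (N x ** T x ** N x)" for x
  \<comment> \<open>The Christoffel part of the Hessian, contracted with a, becomes the
    drift.\<close>
  define b where "b x = (\<chi> l. - (\<Sum>i\<in>UNIV. \<Sum>j\<in>UNIV. a x $ i $ j * christoffel G l i j x))" for x
  define p where "p x = (\<chi> i. partial i F x)" for x
  define H where "H x = (\<chi> i j. partial j (partial i F) x)" for x
  have N_cont: "continuous_on S (\<lambda>x. N x $ i $ j)" for i j
    unfolding N_def
    by (intro Ck_on_imp_continuous_on[of 0] Ck_on_matrix_inv Ck_on_matrix_nth S G) (use det in force)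
  have T_cont: "continuous_on S (\<lambda>x. T x $ i $ j)" for i j
    using continuous_on_einstein_lovelock[OF S G det] by (simp add: T_def dform_matrix_def)
  have a_cont: "continuous_on S (\<lambda>x. a x $ i $ j)" for i j
    unfolding a_def matrix_matrix_mult_def
    by (simp, intro continuous_on_mult continuous_on_sum continuous_on_const N_cont T_cont)
  show ?thesis
  proof (rule strong_maximum_principle[OF S, of F p H a b])
    show "(F has_derivative (\<lambda>h. p x \<bullet> h)) (at x)" if "x \<in> S" for x
      unfolding p_def using FC that by (intro has_derivative_gradient) simp
    show "(p has_derivative (\<lambda>h. H x *v h)) (at x)" if "x \<in> S" for x
      unfolding p_def[abs_def] H_def by (rule has_derivative_hessian[OF that FC])
    show "transpose (H x) = H x" if "x \<in> S" for x
      by (simp add: H_def transpose_def partial_commute[OF S that FC] vec_eq_iff)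
    have "continuous_on S (\<lambda>x. \<chi> i j. a x $ i $ j)"
      by (intro continuous_on_vec_lambda a_cont)
    then show "continuous_on S a" by simp
    show "continuous_on S b"
      unfolding b_def[abs_def]
      by (intro continuous_on_vec_lambda continuous_on_minus continuous_on_sum continuous_on_mult
          a_cont Ck_on_imp_continuous_on[of 0] Ck_on_christoffel S G) (use det in force)
    show "0 < v \<bullet> (a x *v v)" if "x \<in> S" "v \<noteq> 0" for x v
    proof -
      have "v \<bullet> (a x *v v) = s * (v \<bullet> (N x *v (T x *v (N x *v v))))"
        by (simp add: a_def matrix_vector_mul_assoc matrix_mul_assoc flip: scaleR_matrix_vector_assoc)
      also have "v \<bullet> (N x *v (T x *v (N x *v v))) = (N x *v v) \<bullet> (T x *v (N x *v v))"
        by (metis N_sym[OF that(1)] dot_lmul_matrix transpose_matrix_vector)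
      finally show ?thesis
        using s[OF that(1) N_inj[OF that]] by simp
    qed
    show "0 \<le> (\<Sum>i\<in>UNIV. \<Sum>j\<in>UNIV. a x $ i $ j * H x $ i $ j) + b x \<bullet> p x" if "x \<in> S" for x
    proof -
      have "b x \<bullet> p x = - (\<Sum>l\<in>UNIV. \<Sum>i\<in>UNIV. \<Sum>j\<in>UNIV. a x $ i $ j * christoffel G l i j x * partial l F x)"
        by (simp add: b_def p_def inner_vec_def sum_distrib_right sum_negf)
      also have "(\<Sum>l\<in>UNIV. \<Sum>i\<in>UNIV. \<Sum>j\<in>UNIV. a x $ i $ j * christoffel G l i j x * partial l F x)
          = (\<Sum>i\<in>UNIV. \<Sum>l\<in>UNIV. \<Sum>j\<in>UNIV. a x $ i $ j * christoffel G l i j x * partial l F x)"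
        by (rule sum.swap)
      also have "\<dots> = (\<Sum>i\<in>UNIV. \<Sum>j\<in>UNIV. \<Sum>l\<in>UNIV. a x $ i $ j * christoffel G l i j x * partial l F x)"
        by (intro sum.cong refl sum.swap)
      also have "\<dots> = (\<Sum>i\<in>UNIV. \<Sum>j\<in>UNIV. a x $ i $ j * (\<Sum>l\<in>UNIV. christoffel G l i j x * partial l F x))"
        by (simp add: sum_distrib_left mult_ac)
      finally have "(\<Sum>i\<in>UNIV. \<Sum>j\<in>UNIV. a x $ i $ j * H x $ i $ j) + b x \<bullet> p x
          = (\<Sum>i\<in>UNIV. \<Sum>j\<in>UNIV. a x $ i $ j * hessian G F x $ i $ j)"
        by (simp add: hessian_def H_def partial_commute[OF S that FC] right_diff_distrib sum_subtractf)
      also have "\<dots> = s * dform_inner11 (G x) (einstein_lovelock G k x) (dform_of_matrix (hessian G F x))"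
        by (simp add: dform_inner11_eq_sum[OF frame[OF that]] a_def N_def T_def sum_distrib_left mult_ac)
      also have "\<dots> = 0"
        using harm[OF that] by (simp add: lovelock_operator_def)
      finally show ?thesis by simp
    qed
  qed (use max in auto)
qed

section \<open>From charts to the compact connected manifold\<close>

theorem corollary3p11:
  fixes X :: "'a topology"
    and A :: "('a, 'n::{finite,linorder}) chart set"
    and g :: "('a, 'n) chart \<Rightarrow> 'n rvec \<Rightarrow> 'n rmat"
    and k :: nat
    and f :: "'a \<Rightarrow> real"
  assumes "riemannian_manifold X A g"
    and "compact_space X"
    and "connected_space X"
    and "2 * k < CARD('n)"
    and "lovelock_pos_def A g k \<or> lovelock_neg_def A g k"
    and "smooth_function A f"
    and "lovelock_harmonic A g k f"
  shows "\<exists>a. \<forall>p\<in>topspace X. f p = a"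
proof (cases "topspace X = {}")
  case True
  then show ?thesis by simp
next
  case False
  have cover: "(\<Union>c\<in>A. fst c) = topspace X"
    and dom: "\<And>c. c \<in> A \<Longrightarrow> openin X (fst c)"
    and img: "\<And>c. c \<in> A \<Longrightarrow> open (chart_image c)"
    and homeo: "\<And>c. c \<in> A \<Longrightarrow>
      homeomorphic_map (subtopology X (fst c)) (top_of_set (chart_image c)) (snd c)"
    using assms(1) by (auto simp: riemannian_manifold_def smooth_manifold_def)
  have metric: "\<And>c. c \<in> A \<Longrightarrow> smooth_on (chart_image c) (g c)"
    "\<And>c x. c \<in> A \<Longrightarrow> x \<in> chart_image c \<Longrightarrow> transpose (g c x) = g c x"
    "\<And>c x v. c \<in> A \<Longrightarrow> x \<in> chart_image c \<Longrightarrow> v \<noteq> 0 \<Longrightarrow> 0 < vec_inner (g c x) v v"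
    using assms(1) by (auto simp: riemannian_manifold_def riemannian_metric_def)
  have inj: "inj_on (snd c) (fst c)" if "c \<in> A" for c
    using homeomorphic_imp_injective_map[OF homeo[OF that]] openin_subset[OF dom[OF that]]
    by (simp add: Int_absorb1)
  have chart_cont: "continuous_map (subtopology X (fst c)) euclidean (snd c)" if "c \<in> A" for c
    using homeomorphic_imp_continuous_map[OF homeo[OF that]] continuous_map_into_fulltopology by blast
  have f_chart: "(f \<circ> chart_inv c) (snd c q) = f q" if "c \<in> A" "q \<in> fst c" for c q
    using inj[OF that(1)] that(2) by simp
  \<comment> \<open>Smoothness is given only through charts; continuity on X is glued from their
    open domains, so that compactness yields a maximum point.\<close>
  have f_cont: "continuous_map X euclideanreal f"
  proof (rule pasting_lemma[where I = A and T = fst and f = "\<lambda>_. f"])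
    fix c assume c: "c \<in> A"
    have "continuous_on (chart_image c) (f \<circ> chart_inv c)"
      using assms(6) c unfolding smooth_function_def smooth_on_def
      by (meson Ck_on_imp_continuous_on)
    then have "continuous_map (subtopology X (fst c)) euclideanreal ((f \<circ> chart_inv c) \<circ> snd c)"
      by (intro continuous_map_compose[OF homeomorphic_imp_continuous_map[OF homeo[OF c]]]) simp
    then show "continuous_map (subtopology X (fst c)) euclideanreal f"
      by (rule continuous_map_eq) (use f_chart[OF c] in auto)
  next
    show "\<exists>c. c \<in> A \<and> q \<in> fst c \<and> f q = f q" if "q \<in> topspace X" for q
      using that cover by blast
  qed (use dom in auto)
  have "compact (f ` topspace X)"
    using image_compactin[OF assms(2)[unfolded compact_space_def] f_cont] by simp
  then obtain p0 where p0: "p0 \<in> topspace X" "\<And>q. q \<in> topspace X \<Longrightarrow> f q \<le> f p0"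
    using compact_attains_sup[of "f ` topspace X"] False by auto
  define E where "E = {p \<in> topspace X. f p = f p0}"
  have "closedin X {p \<in> topspace X. f p \<in> {f p0}}"
    by (rule closedin_continuous_map_preimage[OF f_cont]) simp
  then have closed: "closedin X E" by (simp add: E_def)
  have "openin X E"
  proof (subst openin_subopen, intro ballI)
    fix p assume p: "p \<in> E"
    then have "p \<in> topspace X" by (simp add: E_def)
    then obtain c where c: "c \<in> A" "p \<in> fst c" using cover by blast
    let ?F = "f \<circ> chart_inv c"
    \<comment> \<open>A point of E is a global maximum of f, so it maximizes the coordinate
      expression on the whole chart image.\<close>
    have max: "?F x \<le> ?F (snd c p)" if x: "x \<in> chart_image c" for x
    proof -
      obtain q where "q \<in> fst c" "x = snd c q" using x by auto
      then show ?thesis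
        using p p0(2)[of q] openin_subset[OF dom[OF c(1)]] f_chart[OF c(1)] c(2) by (auto simp: E_def)
    qed
    have "\<exists>r>0. ball (snd c p) r \<subseteq> chart_image c \<and> (\<forall>x\<in>ball (snd c p) r. ?F x = ?F (snd c p))"
    proof (rule lovelock_harmonic_max_locally_constant[OF img[OF c(1)] metric(1-3)[OF c(1)]])
      show "(\<forall>x\<in>chart_image c. pos_def11 (einstein_lovelock (g c) k x)) \<or>
          (\<forall>x\<in>chart_image c. neg_def11 (einstein_lovelock (g c) k x))"
        using assms(5) c(1) by (auto simp: lovelock_pos_def_def lovelock_neg_def_def)
      show "smooth_on (chart_image c) ?F"
        using assms(6) c(1) by (simp add: smooth_function_def)
      show "lovelock_operator (g c) k ?F x = 0" if "x \<in> chart_image c" for x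
        using assms(7) c(1) that unfolding lovelock_harmonic_def by blast
      show "snd c p \<in> chart_image c" using c(2) by simp
    qed (use max in auto)
    then obtain r where r: "r > 0" "\<And>x. x \<in> ball (snd c p) r \<Longrightarrow> ?F x = ?F (snd c p)" by blast
    \<comment> \<open>The coordinate ball pulled back to a neighbourhood of p in X.\<close>
    define W where "W = {q \<in> topspace (subtopology X (fst c)). snd c q \<in> ball (snd c p) r}"
    have "openin (subtopology X (fst c)) W"
      unfolding W_def by (rule openin_continuous_map_preimage[OF chart_cont[OF c(1)]]) simp
    then have "openin X W"
      using dom[OF c(1)] openin_trans_full by blast
    moreover have "p \<in> W"
      using p c(2) r(1) by (simp add: W_def E_def)
    moreover have "f q = f p0" if "q \<in> W" for q
    proof -
      have q: "q \<in> fst c" "snd c q \<in> ball (snd c p) r"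
        using that by (auto simp: W_def)
      have "f q = ?F (snd c q)" using f_chart[OF c(1) q(1)] by simp
      also have "\<dots> = ?F (snd c p)" by (rule r(2)[OF q(2)])
      also have "\<dots> = f p" by (rule f_chart[OF c])
      finally show ?thesis using p by (simp add: E_def)
    qed
    then have "W \<subseteq> E" by (auto simp: W_def E_def)
    ultimately show "\<exists>W. openin X W \<and> p \<in> W \<and> W \<subseteq> E" by blast
  qed
  then have "E = topspace X"
    using assms(3) closed p0(1) unfolding connected_space_clopen_in by (auto simp: E_def)
  then show ?thesis by (auto simp: E_def)
qed

end
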